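(* Let $K$ be a field of characteristic $0$, let $H=H[a_i]$ be the Heisenberg algebra over $K$ with non-zero parameters $a_i$, and let $V$ be a graded representation of $H$ with distinguished homogeneous basis $\{v_s : s\in S\}$ as described in the context. Let $b\in S$ be such that $v_b$ is a highest weight vector for $H$, and set $G_s := G_{s/b}$ for $s\in S$. Then the $K$-linear map $\Phi: V\to\Lambda_K$ given by $v_s\mapsto G_s(x_1,x_2,\ldots)$ is a map of $H$-modules, where $H$ acts on $\Lambda_K$ by letting $B_{-k}$ act as multiplication by $a_kp_k$ and $B_k$ act as $k\frac{\partial}{\partial p_k}$ for $k\ge 1$.
   Context: Symmetric functions: $\Lambda_K$ is the ring of symmetric functions over $K$ in $x_1,x_2,\ldots$ and $p_k$ is the $k$-th power sum; $\Lambda_K$ is the polynomial ring $K[p_1,p_2,\ldots]$, and $\frac{\partial}{\partial p_k}$ acts on symmetric functions written as polynomials in the power sums. Partitions: for a partition $\lambda$, $m_i(\lambda)$ is the number of parts equal to $i$, and $z_\lambda=\prod_{i\ge1} i^{m_i(\lambda)}m_i(\lambda)!$. Heisenberg algebra: given non-zero parameters $a_k\in K$ ($k\in\mathbb Z\setminus\{0\}$) with $a_k=a_{-k}$, $H=H[a_i]$ is the unital associative $K$-algebra generated by $\{B_k: k\in\mathbb Z\setminus\{0\}\}$ with relations $[B_k,B_l]=k\,a_k\,\delta_{k,-l}$. For a partition $\lambda=(\lambda_1,\ldots,\lambda_l)$ put $B_\lambda=B_{\lambda_1}\cdots B_{\lambda_l}$ and $B_{-\lambda}=B_{-\lambda_1}\cdots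 B_{-\lambda_l}$; for $k\ge 0$ put $D_k=\sum_{\lambda\vdash k}z_\lambda^{-1}B_\lambda$ and $U_k=\sum_{\lambda\vdash k}z_\lambda^{-1}B_{-\lambda}$ (so $D_0=U_0=1$). Representation: $V$ is a representation of $H$ with a distinguished basis $\{v_s: s\in S\}$. Both $V$ and $S$ are $\mathbb Z$-graded, each $v_s$ is homogeneous with $\deg(v_s)=\deg(s)$, each graded component of $V$ is finite-dimensional, and the action is graded in the sense that $\deg(B_k)=-mk$ for some fixed $m\in\mathbb Z\setminus\{0\}$. The inner product $\langle\cdot,\cdot\rangle:V\times V\to K$ is the bilinear form with $\langle v_s,v_{s'}\rangle=\delta_{ss'}$. A vector $v\in V$ is a highest weight vector if $B_k\cdot v=0$ for all $k>0$. Generating function: for $s,t\in S$, $$G_{s/t}(x_1,x_2,\ldots)=\sum_\alpha x^\alpha\langle D_{\alpha_l}D_{\alpha_{l-1}}\cdots D_{\alpha_1}\cdot v_s,v_t\rangle,$$ where $\alpha=(\alpha_1,\alpha_2,\ldots)$ runs over sequences of non-negative integers with finitely many non-zero terms and $x^\alpha=\prod_i x_i^{\alpha_i}$ (the $D_k$ commute, and $D_0=1$). Equivalently $G_{s/t}=\sum_\lambda z_\lambda^{-1}p_\lambda\langle B_\lambda\cdot v_s,v_t\rangle$. These are symmetric functions, homogeneous of degree $(\deg(s)-\deg(t))/m$ (zero if this is negative or non-integral).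
   Formalization: The formal theorem adds the hypothesis ⟨B_{-k}·x, v_b⟩ = 0 for all k>0 and x in V; without it the claim is false (e.g. a sum of two Fock spaces with a mixed basis), and it is necessary, as comparing constant terms shows. *)

theory Defs
  imports "HOL-Library.Poly_Mapping" "HOL-Algebra.Algebraic_Closure_Type"
begin

section \<open>Symmetric functions\<close>

text \<open>
  An exponent vector \<open>\<alpha> :: nat \<Rightarrow>\<^sub>0 nat\<close> stands for the monomial
  \<open>x\<^sub>0\<^bsup>\<alpha> 0\<^esup> x\<^sub>1\<^bsup>\<alpha> 1\<^esup> \<dots>\<close> (the variables are numbered from \<open>0\<close>). A symmetric function is
  a formal power series of bounded degree whose coefficients are invariant under permutations of
  the variables.
\<close>

definition mdeg :: "(nat \<Rightarrow>\<^sub>0 nat) \<Rightarrow> nat" where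
  "mdeg \<alpha> = (\<Sum>i\<in>Poly_Mapping.keys \<alpha>. Poly_Mapping.lookup \<alpha> i)"

definition is_symfun :: "((nat \<Rightarrow>\<^sub>0 nat) \<Rightarrow> 'k::zero) \<Rightarrow> bool" where
  "is_symfun f \<longleftrightarrow>
     (\<forall>\<pi>. bij \<pi> \<longrightarrow> (\<forall>\<alpha>. f (Poly_Mapping.map_key \<pi> \<alpha>) = f \<alpha>)) \<and>
     (\<exists>d. \<forall>\<alpha>. f \<alpha> \<noteq> 0 \<longrightarrow> mdeg \<alpha> \<le> d)"

lemma is_symfunI:
  assumes "\<And>\<pi> \<alpha>. bij \<pi> \<Longrightarrow> f (Poly_Mapping.map_key \<pi> \<alpha>) = f \<alpha>"
    and "\<And>\<alpha>. f \<alpha> \<noteq> 0 \<Longrightarrow> mdeg \<alpha> \<le> d"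
  shows "is_symfun f"
  using assms unfolding is_symfun_def by blast

lemma is_symfun_perm:
  "is_symfun f \<Longrightarrow> bij \<pi> \<Longrightarrow> f (Poly_Mapping.map_key \<pi> \<alpha>) = f \<alpha>"
  unfolding is_symfun_def by blast

lemma is_symfun_bounded:
  assumes "is_symfun f"
  obtains d where "\<And>\<alpha>. f \<alpha> \<noteq> 0 \<Longrightarrow> mdeg \<alpha> \<le> d"
  using assms unfolding is_symfun_def by blast

lemma lookup_map_key_bij:
  "bij \<pi> \<Longrightarrow> Poly_Mapping.lookup (Poly_Mapping.map_key \<pi> \<alpha>) i = Poly_Mapping.lookup \<alpha> (\<pi> i)"
  by (simp add: map_key.rep_eq bij_is_inj)

lemma map_key_add_bij:
  fixes \<alpha> \<beta> :: "nat \<Rightarrow>\<^sub>0 nat"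
  shows "bij \<pi> \<Longrightarrow>
    Poly_Mapping.map_key \<pi> (\<alpha> + \<beta>) = Poly_Mapping.map_key \<pi> \<alpha> + Poly_Mapping.map_key \<pi> \<beta>"
  by (rule poly_mapping_eqI) (simp add: lookup_map_key_bij lookup_add)

lemma map_key_inv_bij:
  fixes \<alpha> :: "nat \<Rightarrow>\<^sub>0 nat"
  assumes "bij \<pi>"
  shows "Poly_Mapping.map_key \<pi> (Poly_Mapping.map_key (inv_into UNIV \<pi>) \<alpha>) = \<alpha>"
    and "Poly_Mapping.map_key (inv_into UNIV \<pi>) (Poly_Mapping.map_key \<pi> \<alpha>) = \<alpha>"
  using assms
  by (auto intro!: poly_mapping_eqI
      simp: lookup_map_key_bij bij_imp_bij_inv inv_f_f bij_is_inj bij_is_surj surj_f_inv_f)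

lemma map_key_eq_iff_bij:
  fixes \<pi> :: "nat \<Rightarrow> nat" and \<alpha> \<beta> :: "nat \<Rightarrow>\<^sub>0 nat"
  assumes "bij \<pi>"
  shows "Poly_Mapping.map_key \<pi> \<alpha> = Poly_Mapping.map_key \<pi> \<beta> \<longleftrightarrow> \<alpha> = \<beta>"
proof
  assume "Poly_Mapping.map_key \<pi> \<alpha> = Poly_Mapping.map_key \<pi> \<beta>"
  from arg_cong[OF this, of "Poly_Mapping.map_key (inv_into UNIV \<pi>)"] show "\<alpha> = \<beta>"
    by (simp only: map_key_inv_bij(2)[OF assms])
qed (rule arg_cong)

lemma map_key_0_bij: "bij (\<pi> :: nat \<Rightarrow> nat) \<Longrightarrow> Poly_Mapping.map_key \<pi> (0 :: nat \<Rightarrow>\<^sub>0 nat) = 0"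
  by (rule poly_mapping_eqI) (simp add: lookup_map_key_bij)

lemma map_key_single_bij:
  fixes \<pi> :: "nat \<Rightarrow> nat"
  assumes "bij \<pi>"
  shows "Poly_Mapping.map_key \<pi> (Poly_Mapping.single i (k::nat)) = Poly_Mapping.single (inv_into UNIV \<pi> i) k"
proof (rule poly_mapping_eqI)
  fix j
  have "i = \<pi> j \<longleftrightarrow> inv_into UNIV \<pi> i = j"
    using bij_inv_eq_iff[OF assms, of j i] by (simp only: eq_commute[of i] eq_commute[of _ j])
  then have "(k when i = \<pi> j) = (k when inv_into UNIV \<pi> i = j)"
    by (rule arg_cong)
  then show "Poly_Mapping.lookup (Poly_Mapping.map_key \<pi> (Poly_Mapping.single i k)) j =
      Poly_Mapping.lookup (Poly_Mapping.single (inv_into UNIV \<pi> i) k) j"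
    by (simp only: lookup_map_key_bij[OF assms] lookup_single)
qed

lemma mdeg_superset:
  assumes "finite A" "Poly_Mapping.keys \<alpha> \<subseteq> A"
  shows "mdeg \<alpha> = (\<Sum>i\<in>A. Poly_Mapping.lookup \<alpha> i)"
  unfolding mdeg_def using assms by (intro sum.mono_neutral_left) (auto simp: in_keys_iff)

lemma mdeg_add: "mdeg (\<alpha> + \<beta>) = mdeg \<alpha> + mdeg \<beta>"
proof -
  let ?A = "Poly_Mapping.keys \<alpha> \<union> Poly_Mapping.keys \<beta>"
  have "mdeg (\<alpha> + \<beta>) = (\<Sum>i\<in>?A. Poly_Mapping.lookup (\<alpha> + \<beta>) i)"
    by (rule mdeg_superset) (simp_all add: Poly_Mapping.keys_add)
  moreover have "mdeg \<alpha> = (\<Sum>i\<in>?A. Poly_Mapping.lookup \<alpha> i)"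
    by (rule mdeg_superset) auto
  moreover have "mdeg \<beta> = (\<Sum>i\<in>?A. Poly_Mapping.lookup \<beta> i)"
    by (rule mdeg_superset) auto
  ultimately show ?thesis by (simp add: lookup_add sum.distrib)
qed

definition splits :: "(nat \<Rightarrow>\<^sub>0 nat) \<Rightarrow> ((nat \<Rightarrow>\<^sub>0 nat) \<times> (nat \<Rightarrow>\<^sub>0 nat)) set" where
  "splits \<alpha> = {(\<beta>, \<gamma>). \<beta> + \<gamma> = \<alpha>}"

lemma finite_splits [simp]: "finite (splits \<alpha>)"
proof -
  let ?D = "{\<beta>. \<exists>\<gamma>. \<beta> + \<gamma> = \<alpha>}"
  let ?P = "PiE (Poly_Mapping.keys \<alpha>) (\<lambda>i. {..Poly_Mapping.lookup \<alpha> i})"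
  let ?r = "\<lambda>\<beta>. restrict (Poly_Mapping.lookup \<beta>) (Poly_Mapping.keys \<alpha>)"
  have zero: "Poly_Mapping.lookup \<beta> i = 0" if "\<beta> \<in> ?D" "i \<notin> Poly_Mapping.keys \<alpha>" for \<beta> i
    using that by (auto simp: in_keys_iff lookup_add)
  have "inj_on ?r ?D"
  proof (rule inj_onI)
    fix \<beta> \<beta>' assume D: "\<beta> \<in> ?D" "\<beta>' \<in> ?D" and eq: "?r \<beta> = ?r \<beta>'"
    show "\<beta> = \<beta>'"
    proof (rule poly_mapping_eqI)
      fix i show "Poly_Mapping.lookup \<beta> i = Poly_Mapping.lookup \<beta>' i"
        using fun_cong[OF eq, of i] zero[OF D(1), of i] zero[OF D(2), of i]
        by (cases "i \<in> Poly_Mapping.keys \<alpha>") auto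
    qed
  qed
  moreover have "?r ` ?D \<subseteq> ?P"
    by (auto simp: lookup_add)
  moreover have "finite ?P"
    by (intro finite_PiE) auto
  ultimately have "finite ?D"
    by (meson finite_imageD finite_subset)
  moreover have "splits \<alpha> \<subseteq> (\<lambda>\<beta>. (\<beta>, \<alpha> - \<beta>)) ` ?D"
    by (auto simp: splits_def image_iff)
  ultimately show ?thesis
    by (meson finite_imageI finite_subset)
qed

text \<open>The Cauchy product of power series.\<close>

definition ps_mult :: "((nat \<Rightarrow>\<^sub>0 nat) \<Rightarrow> 'k::semiring_0) \<Rightarrow> ((nat \<Rightarrow>\<^sub>0 nat) \<Rightarrow> 'k) \<Rightarrow> (nat \<Rightarrow>\<^sub>0 nat) \<Rightarrow> 'k" where
  "ps_mult f g \<alpha> = (\<Sum>(\<beta>, \<gamma>)\<in>splits \<alpha>. f \<beta> * g \<gamma>)"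

lemma is_symfun_mult:
  assumes f: "is_symfun f" and g: "is_symfun g"
  shows "is_symfun (ps_mult f g)"
proof -
  obtain d where d: "\<And>\<alpha>. f \<alpha> \<noteq> 0 \<Longrightarrow> mdeg \<alpha> \<le> d" using is_symfun_bounded[OF f] by blast
  obtain e where e: "\<And>\<alpha>. g \<alpha> \<noteq> 0 \<Longrightarrow> mdeg \<alpha> \<le> e" using is_symfun_bounded[OF g] by blast
  show ?thesis
  proof (rule is_symfunI)
    fix \<pi> :: "nat \<Rightarrow> nat" and \<alpha> assume \<pi>: "bij \<pi>"
    let ?m = "\<lambda>\<pi>. Poly_Mapping.map_key \<pi> :: (nat \<Rightarrow>\<^sub>0 nat) \<Rightarrow> _"
    have \<pi>': "bij (inv_into UNIV \<pi>)" using \<pi> by (rule bij_imp_bij_inv)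
    show "ps_mult f g (?m \<pi> \<alpha>) = ps_mult f g \<alpha>"
      unfolding ps_mult_def
    proof (rule sum.reindex_bij_witness[where i = "map_prod (?m \<pi>) (?m \<pi>)"
          and j = "map_prod (?m (inv_into UNIV \<pi>)) (?m (inv_into UNIV \<pi>))"])
      fix x assume "x \<in> splits (?m \<pi> \<alpha>)"
      then show "map_prod (?m (inv_into UNIV \<pi>)) (?m (inv_into UNIV \<pi>)) x \<in> splits \<alpha>"
        using \<pi> \<pi>' by (auto simp: splits_def map_key_add_bij[symmetric] map_key_inv_bij)
    next
      fix x assume "x \<in> splits \<alpha>"
      then show "map_prod (?m \<pi>) (?m \<pi>) x \<in> splits (?m \<pi> \<alpha>)"
        using \<pi> by (auto simp: splits_def map_key_add_bij)
    qed (use \<pi> \<pi>' f g in \<open>auto simp: map_key_inv_bij is_symfun_perm\<close>)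
  next
    fix \<alpha> assume "ps_mult f g \<alpha> \<noteq> 0"
    then obtain \<beta> \<gamma> where "(\<beta>, \<gamma>) \<in> splits \<alpha>" "f \<beta> * g \<gamma> \<noteq> 0"
      unfolding ps_mult_def by (metis (mono_tags, lifting) case_prod_conv sum.neutral surj_pair)
    moreover from this have "f \<beta> \<noteq> 0" "g \<gamma> \<noteq> 0" by auto
    ultimately show "mdeg \<alpha> \<le> d + e"
      using d e by (fastforce simp: splits_def mdeg_add intro: add_mono)
  qed
qed

lemma ps_mult_assoc: "ps_mult (ps_mult f g) h = ps_mult f (ps_mult g h)"
proof
  fix \<alpha>
  have "ps_mult (ps_mult f g) h \<alpha> =
      (\<Sum>(x, y)\<in>(SIGMA x:splits \<alpha>. splits (fst x)). f (fst y) * g (snd y) * h (snd x))"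
    unfolding ps_mult_def
    by (simp add: sum.Sigma sum_distrib_right case_prod_unfold)
  also have "\<dots> = (\<Sum>(x, y)\<in>(SIGMA x:splits \<alpha>. splits (snd x)). f (fst x) * (g (fst y) * h (snd y)))"
    by (rule sum.reindex_bij_witness[
          where j = "\<lambda>((\<delta>, \<gamma>), (\<beta>, \<beta>')). ((\<beta>, \<beta>' + \<gamma>), (\<beta>', \<gamma>))"
            and i = "\<lambda>((\<beta>, \<delta>), (\<beta>', \<gamma>)). ((\<beta> + \<beta>', \<gamma>), (\<beta>, \<beta>'))"])
      (auto simp: splits_def add.assoc mult.assoc)
  also have "\<dots> = ps_mult f (ps_mult g h) \<alpha>"
    unfolding ps_mult_def
    by (simp add: sum.Sigma sum_distrib_left case_prod_unfold)
  finally show "ps_mult (ps_mult f g) h \<alpha> = ps_mult f (ps_mult g h) \<alpha>" .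
qed

lemma ps_mult_commute: "ps_mult f g = ps_mult g (f :: _ \<Rightarrow> 'k::comm_semiring_0)"
proof
  fix \<alpha> show "ps_mult f g \<alpha> = ps_mult g f \<alpha>"
    unfolding ps_mult_def
    by (rule sum.reindex_bij_witness[where i = prod.swap and j = prod.swap])
      (auto simp: splits_def add.commute mult.commute)
qed

lemma ps_mult_one: "ps_mult (\<lambda>\<alpha>. if \<alpha> = 0 then 1 else 0) f = (f :: _ \<Rightarrow> 'k::semiring_1)"
proof
  fix \<alpha>
  have "ps_mult (\<lambda>\<alpha>. if \<alpha> = 0 then 1 else 0) f \<alpha> =
      (\<Sum>(\<beta>, \<gamma>)\<in>{(0 :: nat \<Rightarrow>\<^sub>0 nat, \<alpha>)}. (if \<beta> = 0 then 1 else 0) * f \<gamma>)"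
    unfolding ps_mult_def
  proof (rule sum.mono_neutral_right)
    show "\<forall>x\<in>splits \<alpha> - {(0, \<alpha>)}. (case x of (\<beta>, \<gamma>) \<Rightarrow> (if \<beta> = 0 then 1 else 0) * f \<gamma>) = 0"
      by (clarsimp simp: splits_def) (metis add_0 mult_zero_left)
  qed (simp, simp add: splits_def)
  then show "ps_mult (\<lambda>\<alpha>. if \<alpha> = 0 then 1 else 0) f \<alpha> = f \<alpha>" by simp
qed

typedef (overloaded) 'k symfun = "{f :: (nat \<Rightarrow>\<^sub>0 nat) \<Rightarrow> 'k::zero. is_symfun f}"
  morphisms symfun_coeff Abs_symfun
  by (rule exI[of _ "\<lambda>_. 0"]) (simp add: is_symfun_def)

setup_lifting type_definition_symfun

lemma is_symfun_add:
  fixes f g :: "_ \<Rightarrow> 'k::monoid_add"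
  assumes f: "is_symfun f" and g: "is_symfun g"
  shows "is_symfun (\<lambda>\<alpha>. f \<alpha> + g \<alpha>)"
proof -
  obtain d where d: "\<And>\<alpha>. f \<alpha> \<noteq> 0 \<Longrightarrow> mdeg \<alpha> \<le> d" using is_symfun_bounded[OF f] by blast
  obtain e where e: "\<And>\<alpha>. g \<alpha> \<noteq> 0 \<Longrightarrow> mdeg \<alpha> \<le> e" using is_symfun_bounded[OF g] by blast
  show ?thesis
  proof (rule is_symfunI)
    fix \<alpha> assume "f \<alpha> + g \<alpha> \<noteq> 0"
    then have "f \<alpha> \<noteq> 0 \<or> g \<alpha> \<noteq> 0" by auto
    then show "mdeg \<alpha> \<le> max d e" using d e by (auto simp: le_max_iff_disj)
  qed (simp add: is_symfun_perm f g)
qed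

lemma is_symfun_map:
  assumes f: "is_symfun f" and h: "h 0 = 0"
  shows "is_symfun (\<lambda>\<alpha>. h (f \<alpha>))"
proof -
  obtain d where d: "\<And>\<alpha>. f \<alpha> \<noteq> 0 \<Longrightarrow> mdeg \<alpha> \<le> d" using is_symfun_bounded[OF f] by blast
  show ?thesis
  proof (rule is_symfunI)
    fix \<alpha> assume "h (f \<alpha>) \<noteq> 0"
    then have "f \<alpha> \<noteq> 0" using h by metis
    then show "mdeg \<alpha> \<le> d" by (rule d)
  qed (simp add: is_symfun_perm f)
qed

lemma is_symfun_one: "is_symfun (\<lambda>\<alpha>. if \<alpha> = 0 then 1 else 0 :: 'k::zero_neq_one)"
proof (rule is_symfunI)
  fix \<pi> :: "nat \<Rightarrow> nat" and \<alpha> :: "nat \<Rightarrow>\<^sub>0 nat" assume "bij \<pi>"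
  then have "Poly_Mapping.map_key \<pi> \<alpha> = 0 \<longleftrightarrow> \<alpha> = 0"
    by (metis map_key_0_bij map_key_eq_iff_bij)
  then show "(if Poly_Mapping.map_key \<pi> \<alpha> = 0 then 1 else 0 :: 'k) = (if \<alpha> = 0 then 1 else 0)"
    by (rule if_cong) simp_all
next
  fix \<alpha> :: "nat \<Rightarrow>\<^sub>0 nat" assume "(if \<alpha> = 0 then 1 else 0 :: 'k) \<noteq> 0"
  then have "\<alpha> = 0" by presburger
  then show "mdeg \<alpha> \<le> 0" by (simp add: mdeg_def)
qed

instantiation symfun :: (comm_ring_1) comm_ring_1
begin

lift_definition zero_symfun :: "'a symfun" is "\<lambda>_. 0"
  by (simp add: is_symfun_def)

lift_definition one_symfun :: "'a symfun" is "\<lambda>\<alpha>. if \<alpha> = 0 then 1 else 0"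
  by (rule is_symfun_one)

lift_definition plus_symfun :: "'a symfun \<Rightarrow> 'a symfun \<Rightarrow> 'a symfun" is "\<lambda>f g \<alpha>. f \<alpha> + g \<alpha>"
  by (rule is_symfun_add)

lift_definition uminus_symfun :: "'a symfun \<Rightarrow> 'a symfun" is "\<lambda>f \<alpha>. - f \<alpha>"
  by (rule is_symfun_map) auto

lift_definition minus_symfun :: "'a symfun \<Rightarrow> 'a symfun \<Rightarrow> 'a symfun" is "\<lambda>f g \<alpha>. f \<alpha> - g \<alpha>"
  by (simp only: diff_conv_add_uminus, rule is_symfun_add, assumption, rule is_symfun_map) auto

lift_definition times_symfun :: "'a symfun \<Rightarrow> 'a symfun \<Rightarrow> 'a symfun" is ps_mult
  by (rule is_symfun_mult)

instance
proof
  fix a b c :: "'a symfun"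
  show "a * b * c = a * (b * c)" by transfer (rule ps_mult_assoc)
  show "a * b = b * a" by transfer (rule ps_mult_commute)
  show "1 * a = a" by transfer (rule ps_mult_one)
  show "(a + b) * c = a * c + b * c"
    by transfer (auto simp: ps_mult_def distrib_right sum.distrib case_prod_beta)
  show "a + b + c = a + (b + c)" by transfer (simp add: add.assoc)
  show "a + b = b + a" by transfer (simp add: add.commute)
  show "0 + a = a" by transfer simp
  show "- a + a = 0" by transfer simp
  show "a - b = a + - b" by transfer simp
  show "(0 :: 'a symfun) \<noteq> 1" by transfer (metis zero_neq_one)
qed

end

lift_definition symfun_scale :: "'k::comm_ring_1 \<Rightarrow> 'k symfun \<Rightarrow> 'k symfun" is "\<lambda>c f \<alpha>. c * f \<alpha>"
  by (rule is_symfun_map) auto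

text \<open>
  The power sum \<open>p\<^sub>k = x\<^sub>0\<^sup>k + x\<^sub>1\<^sup>k + \<dots>\<close>, meaningful for \<open>k \<ge> 1\<close> only.
\<close>

lift_definition power_sum :: "nat \<Rightarrow> 'k::comm_ring_1 symfun" is
  "\<lambda>k \<alpha>. if \<exists>i. \<alpha> = Poly_Mapping.single i k then 1 else 0"
proof -
  fix k
  show "is_symfun (\<lambda>\<alpha>. if \<exists>i. \<alpha> = Poly_Mapping.single i k then 1 else 0 :: 'k)"
  proof (rule is_symfunI[of _ k])
    fix \<pi> :: "nat \<Rightarrow> nat" and \<alpha> :: "nat \<Rightarrow>\<^sub>0 nat" assume \<pi>: "bij \<pi>"
    have "(\<exists>i. Poly_Mapping.map_key \<pi> \<alpha> = Poly_Mapping.single i k) \<longleftrightarrow>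
        (\<exists>i. \<alpha> = Poly_Mapping.single i k)"
      using \<pi> by (metis bij_inv_eq_iff map_key_eq_iff_bij map_key_single_bij)
    then show "(if \<exists>i. Poly_Mapping.map_key \<pi> \<alpha> = Poly_Mapping.single i k then 1 else 0 :: 'k) =
        (if \<exists>i. \<alpha> = Poly_Mapping.single i k then 1 else 0)" by simp
  qed (auto simp: mdeg_def split: if_splits)
qed

text \<open>
  Polynomials in the power sums: in \<open>P :: (nat \<Rightarrow>\<^sub>0 nat) \<Rightarrow>\<^sub>0 'k\<close> the \<open>i\<close>-th variable stands for
  \<open>p\<^bsub>i+1\<^esub>\<close>. Since the power sums freely generate the symmetric functions in characteristic \<open>0\<close>,
  the description in \<open>deriv_p\<close> is unique there.
\<close>

definition eval_p :: "((nat \<Rightarrow>\<^sub>0 nat) \<Rightarrow>\<^sub>0 'k::comm_ring_1) \<Rightarrow> 'k symfun" where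
  "eval_p P = (\<Sum>\<mu>\<in>Poly_Mapping.keys P. symfun_scale (Poly_Mapping.lookup P \<mu>)
      (\<Prod>i\<in>Poly_Mapping.keys \<mu>. power_sum (Suc i) ^ Poly_Mapping.lookup \<mu> i))"

definition pderiv_var :: "nat \<Rightarrow> ((nat \<Rightarrow>\<^sub>0 nat) \<Rightarrow>\<^sub>0 'k::comm_ring_1) \<Rightarrow> ((nat \<Rightarrow>\<^sub>0 nat) \<Rightarrow>\<^sub>0 'k)" where
  "pderiv_var i P = (\<Sum>\<mu>\<in>Poly_Mapping.keys P. Poly_Mapping.single (\<mu> - Poly_Mapping.single i 1)
      (of_nat (Poly_Mapping.lookup \<mu> i) * Poly_Mapping.lookup P \<mu>))"

text \<open>\<open>\<partial>/\<partial>p\<^sub>k\<close>, for \<open>k \<ge> 1\<close>.\<close>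

definition deriv_p :: "nat \<Rightarrow> 'k::comm_ring_1 symfun \<Rightarrow> 'k symfun" where
  "deriv_p k f = eval_p (pderiv_var (k - 1) (THE P. eval_p P = f))"

section \<open>Partitions\<close>

definition partitions_of :: "nat \<Rightarrow> nat list set" where
  "partitions_of n = {xs. sorted_wrt (\<ge>) xs \<and> 0 \<notin> set xs \<and> sum_list xs = n}"

definition zee :: "nat list \<Rightarrow> nat" where
  "zee xs = (\<Prod>i\<in>set xs. i ^ count_list xs i * fact (count_list xs i))"

section \<open>The Heisenberg algebra\<close>

text \<open>
  The free algebra on a set of generators is the monoid algebra of the free monoid, whose
  operation is written additively so that it fits \<^typ>\<open>'a \<Rightarrow>\<^sub>0 'b\<close>.
\<close>

datatype 'x free_monoid = Word "'x list"

instantiation free_monoid :: (type) monoid_add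
begin

definition "0 = Word []"

fun plus_free_monoid where "Word u + Word w = Word (u @ w)"

instance
proof
  fix a b c :: "'a free_monoid"
  show "a + b + c = a + (b + c)" by (cases a; cases b; cases c) simp
  show "0 + a = a" "a + 0 = a" by (cases a; simp add: zero_free_monoid_def)+
qed

end

typedef nonzero_int = "{k :: int. k \<noteq> 0}"
  morphisms int_of_nonzero nonzero_of_int
  by (rule exI[of _ 1]) simp

type_synonym 'k free_heis = "nonzero_int free_monoid \<Rightarrow>\<^sub>0 'k"

text \<open>Meaningful for \<open>k \<noteq> 0\<close> only; likewise \<open>heis_B\<close> below.\<close>

definition gen :: "int \<Rightarrow> 'k::field free_heis" where
  "gen k = Poly_Mapping.single (Word [nonzero_of_int k]) 1"

definition heis_relators :: "(int \<Rightarrow> 'k::field) \<Rightarrow> 'k free_heis set" where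
  "heis_relators a =
     {gen k * gen l - gen l * gen k
        - Poly_Mapping.single 0 (if k = - l then of_int k * a k else 0) | k l. k \<noteq> 0 \<and> l \<noteq> 0}"

definition heis_ideal :: "(int \<Rightarrow> 'k::field) \<Rightarrow> 'k free_heis set" where
  "heis_ideal a = genideal ring_of_type_algebra (heis_relators a)"

definition heis :: "(int \<Rightarrow> 'k::field) \<Rightarrow> 'k free_heis set ring" where
  "heis a = ring_of_type_algebra Quot heis_ideal a"

definition heis_class :: "(int \<Rightarrow> 'k::field) \<Rightarrow> 'k free_heis \<Rightarrow> 'k free_heis set" where
  "heis_class a x = heis_ideal a +>\<^bsub>ring_of_type_algebra\<^esub> x"

definition heis_scale :: "(int \<Rightarrow> 'k::field) \<Rightarrow> 'k \<Rightarrow> 'k free_heis set \<Rightarrow> 'k free_heis set" where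
  "heis_scale a c h = heis_class a (Poly_Mapping.single 0 c) \<otimes>\<^bsub>heis a\<^esub> h"

definition heis_B :: "(int \<Rightarrow> 'k::field) \<Rightarrow> int \<Rightarrow> 'k free_heis set" where
  "heis_B a k = heis_class a (gen k)"

definition heis_prod :: "(int \<Rightarrow> 'k::field) \<Rightarrow> 'k free_heis set list \<Rightarrow> 'k free_heis set" where
  "heis_prod a hs = foldr (\<otimes>\<^bsub>heis a\<^esub>) hs \<one>\<^bsub>heis a\<^esub>"

definition heis_D :: "(int \<Rightarrow> 'k::field) \<Rightarrow> nat \<Rightarrow> 'k free_heis set" where
  "heis_D a n = (\<Oplus>\<^bsub>heis a\<^esub> xs\<in>partitions_of n.
     heis_scale a (inverse (of_nat (zee xs))) (heis_prod a (map (\<lambda>i. heis_B a (int i)) xs)))"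

text \<open>
  The product \<open>\<dots> D\<^bsub>\<alpha> 1\<^esub> D\<^bsub>\<alpha> 0\<^esub>\<close>, cut off behind the last non-zero entry of \<open>\<alpha>\<close>.
\<close>

definition heis_D_seq :: "(int \<Rightarrow> 'k::field) \<Rightarrow> (nat \<Rightarrow>\<^sub>0 nat) \<Rightarrow> 'k free_heis set" where
  "heis_D_seq a \<alpha> = heis_prod a
     (map (\<lambda>i. heis_D a (Poly_Mapping.lookup \<alpha> i)) (rev [0..<Poly_Mapping.degree \<alpha>]))"

section \<open>Representations\<close>

locale heis_rep = vector_space scale
  for scale :: "'k::field \<Rightarrow> 'v::ab_group_add \<Rightarrow> 'v" +
  fixes a :: "int \<Rightarrow> 'k" and act :: "'k free_heis set \<Rightarrow> 'v \<Rightarrow> 'v"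
  assumes act_linear: "h \<in> carrier (heis a) \<Longrightarrow> Vector_Spaces.linear scale scale (act h)"
    and act_one: "act \<one>\<^bsub>heis a\<^esub> x = x"
    and act_mult: "\<lbrakk>h \<in> carrier (heis a); h' \<in> carrier (heis a)\<rbrakk>
      \<Longrightarrow> act (h \<otimes>\<^bsub>heis a\<^esub> h') x = act h (act h' x)"
    and act_add: "\<lbrakk>h \<in> carrier (heis a); h' \<in> carrier (heis a)\<rbrakk>
      \<Longrightarrow> act (h \<oplus>\<^bsub>heis a\<^esub> h') x = act h x + act h' x"
    and act_scale: "h \<in> carrier (heis a) \<Longrightarrow> act (heis_scale a c h) x = scale c (act h x)"

locale graded_heis_rep = heis_rep scale a act
  for scale :: "'k::field \<Rightarrow> 'v::ab_group_add \<Rightarrow> 'v"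
    and a :: "int \<Rightarrow> 'k" and act :: "'k free_heis set \<Rightarrow> 'v \<Rightarrow> 'v" +
  fixes v :: "'s \<Rightarrow> 'v" and sdeg :: "'s \<Rightarrow> int" and comp :: "int \<Rightarrow> 'v set" and m :: int
    and form :: "'v \<Rightarrow> 'v \<Rightarrow> 'k"
  assumes basis: "inj v" "independent (range v)" "span (range v) = UNIV"
    and comp_subspace: "subspace (comp n)"
    and comp_direct_sum: "\<exists>!f. (\<forall>n. f n \<in> comp n) \<and> finite {n. f n \<noteq> 0} \<and> x = (\<Sum>n | f n \<noteq> 0. f n)"
    and comp_finite_dim: "\<exists>C. finite C \<and> span C = comp n"
    and basis_homogeneous: "v s \<in> comp (sdeg s)"
    and m_nonzero: "m \<noteq> 0"
    and act_graded: "k \<noteq> 0 \<Longrightarrow> x \<in> comp n \<Longrightarrow> act (heis_B a k) x \<in> comp (n - m * k)"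
    and form_linear_left: "Vector_Spaces.linear scale (*) (\<lambda>x. form x y)"
    and form_linear_right: "Vector_Spaces.linear scale (*) (\<lambda>y. form x y)"
    and form_basis: "form (v s) (v t) = (if s = t then 1 else 0)"
begin

text \<open>
  For a basis vector \<open>v b\<close> being a highest weight vector does not force its coefficient functional
  \<open>\<lambda>x. form x (v b)\<close> to vanish on the images of the \<open>B\<^bsub>-k\<^esub>\<close>, \<open>k > 0\<close>, because \<open>form\<close> need not be
  contravariant. For instance, let \<open>V\<close> be the sum of two Fock spaces with vacua \<open>u\<close> in degree \<open>0\<close>
  and \<open>u'\<close> in degree \<open>m\<close>, with a homogeneous basis that contains \<open>u\<close>, \<open>v b = u'\<close> and
  \<open>B\<^bsub>-1\<^esub> u + u'\<close>; then \<open>form (B\<^bsub>-1\<^esub> u) (v b) = -1\<close>. A map \<open>v s \<mapsto> G\<^bsub>s/b\<^esub>\<close> can only commute with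
  \<open>B\<^bsub>-k\<^esub>\<close> if that functional does vanish there (compare constant terms).
\<close>

definition highest_weight :: "'v \<Rightarrow> bool" where
  "highest_weight x \<longleftrightarrow> (\<forall>k>0. act (heis_B a k) x = 0)"

text \<open>The coefficient of \<open>x\<^sup>\<alpha>\<close> in \<open>G\<^bsub>s/t\<^esub>\<close>.\<close>

definition gen_fun :: "'s \<Rightarrow> 's \<Rightarrow> (nat \<Rightarrow>\<^sub>0 nat) \<Rightarrow> 'k" where
  "gen_fun s t \<alpha> = form (act (heis_D_seq a \<alpha>) (v s)) (v t)"

end

end

theory Submission
  imports Defs "HOL-Combinatorics.Permutations"
begin

text \<open>
  Write \<open>B\<^sup>\<mu>\<close> for the monomial in the commuting operators \<open>B\<^sub>k\<close>, \<open>k > 0\<close>, with exponent vector \<open>\<mu>\<close>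
  and \<open>\<epsilon>\<close> for the functional \<open>\<langle>\<cdot>, v\<^sub>b\<rangle>\<close>. The polynomial \<open>\<Psi> x = \<Sum>\<^sub>\<mu> z\<^sub>\<mu>\<^sup>-\<^sup>1 \<epsilon>(B\<^sup>\<mu> x) p\<^sup>\<mu>\<close> is finite by the
  grading. Reading off coefficients gives \<open>\<Psi> (B\<^sub>k x) = k \<partial>\<Psi> x/\<partial>p\<^sub>k\<close>, while
  \<open>B\<^sup>\<mu> B\<^bsub>-k\<^esub> = B\<^bsub>-k\<^esub> B\<^sup>\<mu> + k a\<^sub>k \<mu>\<^sub>k B\<^bsup>\<mu>-k\<^esup>\<close> and \<open>\<epsilon> \<circ> B\<^bsub>-k\<^esub> = 0\<close> give \<open>\<Psi> (B\<^bsub>-k\<^esub> x) = a\<^sub>k p\<^sub>k \<Psi> x\<close>.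
  The coefficient of \<open>x\<^sup>\<alpha>\<close> in \<open>\<Psi> x\<close> is \<open>\<epsilon>(D\<^sub>\<alpha> x)\<close>, because multiplication by \<open>p\<^sub>k\<close> changes both
  sides by the same recursion: on the side of the operators it is \<open>[D\<^sub>n, p\<^sub>k] = D\<^bsub>n-k\<^esub>\<close>.

  That \<open>\<partial>/\<partial>p\<^sub>k\<close> is defined on all symmetric functions requires that the power sums generate
  them freely. This follows from triangularity with respect to the number of variables in a
  monomial: \<open>p\<^sup>\<nu>\<close> contains no monomial in more than \<open>|\<nu>|\<close> variables, and those in exactly
  \<open>|\<nu>|\<close> variables are the rearrangements of the partition \<open>\<nu>\<close>, with coefficient \<open>\<Prod>\<^sub>i \<nu>\<^sub>i!\<close>.
\<close>

text \<open>Reduces additive statements about polynomials, and about elements of the free algebra,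
  to single terms.\<close>

lemma poly_mapping_add_induct [case_names single add]:
  assumes single: "\<And>k c. P (Poly_Mapping.single k c)"
    and add: "\<And>p q. P p \<Longrightarrow> P q \<Longrightarrow> P (p + q)"
  shows "P (p :: 'a \<Rightarrow>\<^sub>0 'b::monoid_add)"
proof (induction p rule: update_induct)
  case const
  show ?case using single[of undefined 0] by simp
next
  case (update f k v)
  have "Poly_Mapping.update k v f = f + Poly_Mapping.single k v"
    using update(1) by (intro poly_mapping_eqI)
      (auto simp: lookup_update lookup_add lookup_single when_def in_keys_iff)
  then show ?case using update add single by metis
qed

section \<open>The Heisenberg algebra as a quotient of the free algebra\<close>

lemma ring_of_type_algebra_ring: "ring (ring_of_type_algebra :: 'a::ring_1 ring)"
proof -
  have "\<exists>y. x + y = 0" for x :: 'a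
    using add.right_inverse by blast
  then show ?thesis
    unfolding ring_of_type_algebra_def using add.right_inverse
    by unfold_locales (auto simp: algebra_simps Units_def)
qed

lemma ideal_heis_ideal: "ideal (heis_ideal a) ring_of_type_algebra"
  unfolding heis_ideal_def
  by (rule ring.genideal_ideal[OF ring_of_type_algebra_ring]) (simp add: ring_of_type_algebra_def)

lemma ring_heis: "ring (heis a)"
  unfolding heis_def by (rule ideal.quotient_is_ring[OF ideal_heis_ideal])

lemma heis_class_ring_hom: "heis_class a \<in> ring_hom ring_of_type_algebra (heis a)"
  using ideal.rcos_ring_hom[OF ideal_heis_ideal, of a]
  unfolding heis_def heis_class_def by simp

lemma heis_class_add: "heis_class a (x + y) = heis_class a x \<oplus>\<^bsub>heis a\<^esub> heis_class a y"
  using ring_hom_add[OF heis_class_ring_hom, of x y] by (simp add: ring_of_type_algebra_def)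

lemma heis_class_mult: "heis_class a (x * y) = heis_class a x \<otimes>\<^bsub>heis a\<^esub> heis_class a y"
  using ring_hom_mult[OF heis_class_ring_hom, of x y] by (simp add: ring_of_type_algebra_def)

lemma heis_class_one: "heis_class a 1 = \<one>\<^bsub>heis a\<^esub>"
  using ring_hom_one[OF heis_class_ring_hom] by (simp add: ring_of_type_algebra_def)

lemma heis_class_carrier [simp]: "heis_class a x \<in> carrier (heis a)"
  using ring_hom_closed[OF heis_class_ring_hom] by (simp add: ring_of_type_algebra_def)

lemma heis_B_carrier [simp]: "heis_B a k \<in> carrier (heis a)"
  by (simp add: heis_B_def)

lemma heis_carrierE:
  assumes "h \<in> carrier (heis a)"
  obtains x where "h = heis_class a x"
  using assms by (auto simp: heis_def heis_class_def FactRing_def A_RCOSETS_defs a_r_coset_def)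

lemma heis_class_eq_iff: "heis_class a x = heis_class a y \<longleftrightarrow> x - y \<in> heis_ideal a"
proof -
  let ?R = "ring_of_type_algebra :: 'a free_heis ring"
  interpret R: ring ?R by (rule ring_of_type_algebra_ring)
  interpret ideal "heis_ideal a" ?R by (rule ideal_heis_ideal)
  have "\<ominus>\<^bsub>?R\<^esub> y = - y"
    by (rule R.minus_equality) (auto simp: ring_of_type_algebra_def)
  then have "x \<ominus>\<^bsub>?R\<^esub> y = x - y"
    by (simp add: a_minus_def) (simp add: ring_of_type_algebra_def)
  then show ?thesis
    using R.quotient_eq_iff_same_a_r_cos[OF ideal_heis_ideal, of x y]
    by (auto simp: heis_class_def ring_of_type_algebra_def)
qed

lemma heis_relators_subset: "heis_relators a \<subseteq> heis_ideal a"
  unfolding heis_ideal_def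
  by (rule ring.genideal_self[OF ring_of_type_algebra_ring]) (simp add: ring_of_type_algebra_def)

text \<open>A word is a product of letters and its coefficient can stay on the empty word, so
  scalars and generators suffice.\<close>

lemma free_heis_induct [case_names const gen add mult]:
  fixes x :: "'k::field free_heis"
  assumes const: "\<And>c. P (Poly_Mapping.single 0 c)"
    and gen: "\<And>k. k \<noteq> 0 \<Longrightarrow> P (gen k)"
    and add: "\<And>x y. P x \<Longrightarrow> P y \<Longrightarrow> P (x + y)"
    and mult: "\<And>x y. P x \<Longrightarrow> P y \<Longrightarrow> P (x * y)"
  shows "P x"
proof (induction x rule: poly_mapping_add_induct)
  case (single w c)
  have "P (Poly_Mapping.single (Word ks) c)" for ks
  proof (induction ks)
    case Nil
    show ?case using const by (simp add: zero_free_monoid_def)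
  next
    case (Cons k ks)
    have "Poly_Mapping.single (Word (k # ks)) c = gen (int_of_nonzero k) * Poly_Mapping.single (Word ks) c"
      by (simp add: gen_def mult_single int_of_nonzero_inverse)
    moreover have "int_of_nonzero k \<noteq> 0"
      using int_of_nonzero by simp
    ultimately show ?case using Cons gen mult by simp
  qed
  then show ?case by (cases w) simp
qed (rule add)

subsection \<open>Representations from operators\<close>

definition word_op :: "(int \<Rightarrow> 'v \<Rightarrow> 'v) \<Rightarrow> nonzero_int free_monoid \<Rightarrow> 'v \<Rightarrow> 'v" where
  "word_op B w = (case w of Word ks \<Rightarrow> foldr (\<lambda>k. B (int_of_nonzero k)) ks)"

lemma word_op_add: "word_op B (u + w) x = word_op B u (word_op B w x)"
  by (cases u; cases w) (simp add: word_op_def)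

text \<open>The evaluation homomorphism that the universal property of the free algebra attaches to
  the operators \<open>B k\<close>.\<close>

definition free_eval ::
    "('k::field \<Rightarrow> 'v::ab_group_add \<Rightarrow> 'v) \<Rightarrow> (int \<Rightarrow> 'v \<Rightarrow> 'v) \<Rightarrow> 'k free_heis \<Rightarrow> 'v \<Rightarrow> 'v" where
  "free_eval scale B F x =
     (\<Sum>w\<in>Poly_Mapping.keys F. scale (Poly_Mapping.lookup F w) (word_op B w x))"

context
  fixes scale :: "'k::field \<Rightarrow> 'v::ab_group_add \<Rightarrow> 'v" and B :: "int \<Rightarrow> 'v \<Rightarrow> 'v"
  assumes vs: "vector_space scale"
    and lin: "\<And>k. k \<noteq> 0 \<Longrightarrow> Vector_Spaces.linear scale scale (B k)"
begin

interpretation vector_space scale by (rule vs)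
interpretation vector_space_pair scale scale by unfold_locales

lemma word_op_linear: "Vector_Spaces.linear scale scale (word_op B w)"
proof -
  have "Vector_Spaces.linear scale scale (foldr (\<lambda>k. B (int_of_nonzero k)) ks)" for ks
  proof (induction ks)
    case (Cons k ks)
    have "int_of_nonzero k \<noteq> 0" using int_of_nonzero by simp
    from Vector_Spaces.linear_compose[OF Cons lin[OF this]] show ?case
      by (simp add: o_def)
  qed (simp add: id_def linear_id[unfolded id_def])
  then show ?thesis by (cases w) (simp add: word_op_def)
qed

lemma free_eval_add: "free_eval scale B (F + G) x = free_eval scale B F x + free_eval scale B G x"
  unfolding free_eval_def by (rule setsum_keys_plus_distrib) (simp_all add: scale_left_distrib)

lemma free_eval_single: "free_eval scale B (Poly_Mapping.single w c) x = scale c (word_op B w x)"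
  by (cases "c = 0") (simp_all add: free_eval_def)

lemma free_eval_linear: "Vector_Spaces.linear scale scale (free_eval scale B F)"
proof (induction F rule: poly_mapping_add_induct)
  case (single w c)
  show ?case
    using linear_compose_scale_right[OF word_op_linear]
    by (simp add: free_eval_single[abs_def])
next
  case (add F G)
  then show ?case using linear_compose_add by (simp add: free_eval_add[abs_def])
qed

lemma free_eval_mult: "free_eval scale B (F * G) x = free_eval scale B F (free_eval scale B G x)"
proof (induction F rule: poly_mapping_add_induct)
  case (single w c)
  show ?case
  proof (induction G rule: poly_mapping_add_induct)
    case (single u d)
    show ?case
      by (simp add: mult_single free_eval_single word_op_add linear_scale[OF word_op_linear])
  next
    case (add G H)
    then show ?case by (simp add: distrib_left free_eval_add linear_add[OF free_eval_linear])
  qed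
qed (simp add: distrib_right free_eval_add)

lemma free_eval_gen: "k \<noteq> 0 \<Longrightarrow> free_eval scale B (gen k) x = B k x"
  by (simp add: gen_def free_eval_single word_op_def nonzero_of_int_inverse)

lemma free_eval_const: "free_eval scale B (Poly_Mapping.single 0 c) x = scale c x"
  by (simp add: free_eval_single word_op_def zero_free_monoid_def)

lemma free_eval_uminus: "free_eval scale B (- F) x = - free_eval scale B F x"
  using free_eval_add[of F "- F" x] by (simp add: free_eval_def minus_unique)

lemma free_eval_diff: "free_eval scale B (F - G) x = free_eval scale B F x - free_eval scale B G x"
  using free_eval_add[of "F - G" G x] by (simp add: eq_diff_eq)

text \<open>The universal property of the presented algebra: the free elements that evaluate to the
  zero operator form a two-sided ideal, \<open>rel\<close> puts the relators into it, hence
  evaluation factors through the quotient.\<close>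

lemma heis_rep_of_operators:
  assumes rel: "\<And>k l x. k \<noteq> 0 \<Longrightarrow> l \<noteq> 0 \<Longrightarrow>
      B k (B l x) - B l (B k x) = (if k = - l then scale (of_int k * a k) x else 0)"
  obtains \<sigma> where "heis_rep scale a \<sigma>" "\<And>k. k \<noteq> 0 \<Longrightarrow> \<sigma> (heis_B a k) = B k"
proof -
  let ?\<tau> = "free_eval scale B"
  let ?R = "ring_of_type_algebra :: 'k free_heis ring"
  interpret R: ring ?R by (rule ring_of_type_algebra_ring)
  define J where "J = {F. \<forall>x. ?\<tau> F x = 0}"
  have um: "\<ominus>\<^bsub>?R\<^esub> y = - y" for y
    by (rule R.minus_equality) (auto simp: ring_of_type_algebra_def)
  have "ideal J ?R"
  proof (rule idealI)
    show "ring ?R" ..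
    show "subgroup J (add_monoid ?R)"
    proof (rule group.subgroupI)
      show "group (add_monoid ?R)" by (rule R.a_group)
      show "J \<noteq> {}" by (auto simp: J_def free_eval_def intro!: exI[of _ 0])
      show "inv\<^bsub>add_monoid ?R\<^esub> y \<in> J" if "y \<in> J" for y
        using that um[of y] by (simp add: J_def a_inv_def free_eval_uminus)
    qed (auto simp: J_def ring_of_type_algebra_def free_eval_add)
  qed (auto simp: J_def ring_of_type_algebra_def free_eval_mult linear_0[OF free_eval_linear])
  moreover have "heis_relators a \<subseteq> J"
  proof
    fix F assume "F \<in> heis_relators a"
    then show "F \<in> J"
      by (auto simp: J_def heis_relators_def free_eval_diff free_eval_mult free_eval_gen
          free_eval_const rel simp del: single_zero split: if_splits)
  qed
  ultimately have "heis_ideal a \<subseteq> J"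
    unfolding heis_ideal_def by (rule R.genideal_minimal)
  then have cong: "?\<tau> F = ?\<tau> G" if "heis_class a F = heis_class a G" for F G
    using that unfolding heis_class_eq_iff J_def by (auto simp: free_eval_diff fun_eq_iff)
  \<comment> \<open>By \<open>cong\<close> any representative of a class gives the same operator.
    Outside the carrier the choice is arbitrary.\<close>
  define \<sigma> where "\<sigma> h = ?\<tau> (SOME F. h = heis_class a F)" for h
  have \<sigma>: "\<sigma> (heis_class a F) = ?\<tau> F" for F
    unfolding \<sigma>_def by (rule cong) (metis (mono_tags) someI)
  have one: "(1 :: 'k free_heis) = Poly_Mapping.single 0 1" by simp
  show thesis
  proof (rule that)
    show "heis_rep scale a \<sigma>"
    proof unfold_locales
      show "\<sigma> h (x + y) = \<sigma> h x + \<sigma> h y" "\<sigma> h (scale c x) = scale c (\<sigma> h x)"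
        if "h \<in> carrier (heis a)" for h c x y
        using that by (auto elim!: heis_carrierE
            simp: \<sigma> linear_add[OF free_eval_linear] linear_scale[OF free_eval_linear])
      show "\<sigma> \<one>\<^bsub>heis a\<^esub> x = x" for x
        by (simp add: heis_class_one[symmetric] \<sigma> one free_eval_const del: single_one)
    qed (auto elim!: heis_carrierE simp: \<sigma> free_eval_linear heis_class_mult[symmetric]
        heis_class_add[symmetric] free_eval_add free_eval_mult heis_scale_def free_eval_const)
    show "\<sigma> (heis_B a k) = B k" if "k \<noteq> 0" for k
      using that by (simp add: heis_B_def \<sigma> free_eval_gen fun_eq_iff)
  qed
qed

end

section \<open>The action of sums, products and the elements D in a representation\<close>

context heis_rep
begin

lemma act_const: "act (heis_class a (Poly_Mapping.single 0 c)) x = scale c x"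
proof -
  interpret H: ring "heis a" by (rule ring_heis)
  show ?thesis
    using act_scale[of "\<one>\<^bsub>heis a\<^esub>" c x] by (simp add: act_one heis_scale_def)
qed

lemma act_class_add: "act (heis_class a (F + G)) x = act (heis_class a F) x + act (heis_class a G) x"
  by (simp add: heis_class_add act_add)

lemma act_class_mult: "act (heis_class a (F * G)) x = act (heis_class a F) (act (heis_class a G) x)"
  by (simp add: heis_class_mult act_mult)

lemma act_B_commute:
  assumes "k \<noteq> 0" "l \<noteq> 0"
  shows "act (heis_B a k) (act (heis_B a l) x) =
    act (heis_B a l) (act (heis_B a k) x) + (if k = - l then scale (of_int k * a k) x else 0)"
proof -
  let ?c = "if k = - l then of_int k * a k else 0"
  have "gen k * gen l - gen l * gen k - Poly_Mapping.single 0 ?c \<in> heis_ideal a"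
    using heis_relators_subset assms by (fastforce simp: heis_relators_def)
  then have "heis_class a (gen k * gen l) =
      heis_class a (gen l * gen k + Poly_Mapping.single 0 ?c)"
    by (simp only: heis_class_eq_iff diff_diff_add)
  then have "act (heis_class a (gen k * gen l)) x =
      act (heis_class a (gen l * gen k + Poly_Mapping.single 0 ?c)) x"
    by simp
  then show ?thesis
    by (simp only: act_class_add act_class_mult act_const heis_B_def) simp
qed

lemma act_heis_prod:
  assumes "set hs \<subseteq> carrier (heis a)"
  shows "heis_prod a hs \<in> carrier (heis a) \<and> act (heis_prod a hs) x = foldr act hs x"
proof -
  interpret H: ring "heis a" by (rule ring_heis)
  show ?thesis
    using assms by (induction hs) (auto simp: heis_prod_def act_one act_mult)
qed

lemma act_finsum:
  assumes "finite A" "\<And>i. i \<in> A \<Longrightarrow> f i \<in> carrier (heis a)"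
  shows "act (\<Oplus>\<^bsub>heis a\<^esub>i\<in>A. f i) x = (\<Sum>i\<in>A. act (f i) x)"
proof -
  interpret H: ring "heis a" by (rule ring_heis)
  have "act \<zero>\<^bsub>heis a\<^esub> x = 0"
    using act_add[of "\<zero>\<^bsub>heis a\<^esub>" "\<zero>\<^bsub>heis a\<^esub>" x] by simp
  with assms show ?thesis
    by (induction A rule: finite_induct) (auto simp: H.finsum_insert act_add Pi_def)
qed

lemma heis_scale_carrier: "h \<in> carrier (heis a) \<Longrightarrow> heis_scale a c h \<in> carrier (heis a)"
  using ring.ring_simprules(5)[OF ring_heis[of a]] by (simp add: heis_scale_def)

lemma heis_D_carrier: "heis_D a n \<in> carrier (heis a)"
proof -
  interpret H: ring "heis a" by (rule ring_heis)
  show ?thesis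
    unfolding heis_D_def
    by (rule H.finsum_closed) (auto intro!: heis_scale_carrier act_heis_prod[THEN conjunct1])
qed

lemma act_heis_D:
  assumes "finite (partitions_of n)"
  shows "act (heis_D a n) x = (\<Sum>xs\<in>partitions_of n.
    scale (inverse (of_nat (zee xs))) (foldr (\<lambda>i. act (heis_B a (int i))) xs x))"
proof -
  have prod: "heis_prod a (map (\<lambda>i. heis_B a (int i)) xs) \<in> carrier (heis a)"
    "act (heis_prod a (map (\<lambda>i. heis_B a (int i)) xs)) x = foldr (\<lambda>i. act (heis_B a (int i))) xs x"
    for xs
    using act_heis_prod[of "map (\<lambda>i. heis_B a (int i)) xs" x] by (auto simp: foldr_map o_def image_subset_iff)
  show ?thesis
    unfolding heis_D_def using assms
    by (simp add: act_finsum heis_scale_carrier act_scale prod)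
qed

text \<open>The factor with index 0 stands rightmost in the product and so acts first; this gives a
  \<open>fold\<close> over increasing indices, which suits induction on the length.\<close>

lemma act_heis_D_seq:
  "act (heis_D_seq a \<alpha>) x =
    fold (\<lambda>i. act (heis_D a (Poly_Mapping.lookup \<alpha> i))) [0..<Poly_Mapping.degree \<alpha>] x"
proof -
  have "act (heis_D_seq a \<alpha>) x =
      foldr act (map (\<lambda>i. heis_D a (Poly_Mapping.lookup \<alpha> i)) (rev [0..<Poly_Mapping.degree \<alpha>])) x"
    unfolding heis_D_seq_def by (rule act_heis_prod[THEN conjunct2]) (auto simp: heis_D_carrier)
  then show ?thesis by (simp add: foldr_conv_fold rev_map fold_map o_def)
qed

end

text \<open>The elements whose action commutes with \<Phi> are closed under sums and products and
  contain the scalars by linearity; with the generators they are the whole algebra.\<close>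

lemma heis_rep_intertwine:
  assumes rep: "heis_rep scale a act" and rep': "heis_rep scale' a act'"
    and lin: "Vector_Spaces.linear scale scale' \<Phi>"
    and B: "\<And>k x. k \<noteq> 0 \<Longrightarrow> \<Phi> (act (heis_B a k) x) = act' (heis_B a k) (\<Phi> x)"
    and h: "h \<in> carrier (heis a)"
  shows "\<Phi> (act h x) = act' h (\<Phi> x)"
proof -
  interpret V: heis_rep scale a act by (rule rep)
  interpret W: heis_rep scale' a act' by (rule rep')
  interpret Vector_Spaces.linear scale scale' \<Phi> by (rule lin)
  obtain F where F: "h = heis_class a F" using h by (rule heis_carrierE)
  have "\<Phi> (act (heis_class a F) x) = act' (heis_class a F) (\<Phi> x)" for x
    by (induction F arbitrary: x rule: free_heis_induct)
      (simp_all add: V.act_const W.act_const scale V.act_class_add W.act_class_add add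
        V.act_class_mult W.act_class_mult B[unfolded heis_B_def])
  then show ?thesis by (simp add: F)
qed

section \<open>Exponent vectors\<close>

lemma mdeg_0 [simp]: "mdeg 0 = 0"
  by (simp add: mdeg_def)

lemma mdeg_single [simp]: "mdeg (Poly_Mapping.single k n) = n"
  by (cases "n = 0") (simp_all add: mdeg_def)

lemma lookup_le_mdeg: "Poly_Mapping.lookup \<alpha> i \<le> mdeg \<alpha>"
  by (cases "i \<in> Poly_Mapping.keys \<alpha>")
    (auto simp: mdeg_def in_keys_iff intro: member_le_sum)

text \<open>Subtraction of exponent vectors truncates at 0; the inequality is exactly what makes it
  undo the addition.\<close>

lemma single_add_eq_iff:
  fixes \<mu> \<nu> :: "nat \<Rightarrow>\<^sub>0 nat"
  shows "Poly_Mapping.single k n + \<nu> = \<mu> \<longleftrightarrow>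
    n \<le> Poly_Mapping.lookup \<mu> k \<and> \<nu> = \<mu> - Poly_Mapping.single k n"
proof
  assume *: "n \<le> Poly_Mapping.lookup \<mu> k \<and> \<nu> = \<mu> - Poly_Mapping.single k n"
  show "Poly_Mapping.single k n + \<nu> = \<mu>"
    by (rule poly_mapping_eqI) (use * in \<open>auto simp: lookup_add lookup_minus lookup_single when_def\<close>)
qed (auto simp: lookup_add)

text \<open>Peels off one unit at a time by induction on \<open>mdeg\<close>. For monomials in the
  power sums a step is multiplication by one power sum.\<close>

lemma exponent_induct [case_names zero add]:
  fixes \<nu> :: "nat \<Rightarrow>\<^sub>0 nat"
  assumes zero: "P 0" and add: "\<And>k \<nu>. P \<nu> \<Longrightarrow> P (Poly_Mapping.single k 1 + \<nu>)"
  shows "P \<nu>"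
proof (induction "mdeg \<nu>" arbitrary: \<nu>)
  case 0
  then have "\<nu> = 0"
    using lookup_le_mdeg[of \<nu>] by (intro poly_mapping_eqI) simp
  then show ?case using zero by simp
next
  case (Suc n)
  then obtain k where "Poly_Mapping.lookup \<nu> k \<noteq> 0"
    by (metis lookup_zero mdeg_0 nat.distinct(1) poly_mapping_eqI)
  then have \<nu>: "Poly_Mapping.single k 1 + (\<nu> - Poly_Mapping.single k 1) = \<nu>"
    by (subst single_add_eq_iff) auto
  with Suc(2) have "mdeg (\<nu> - Poly_Mapping.single k 1) = n"
    by (metis add_Suc_right add_0 mdeg_add mdeg_single nat.inject plus_1_eq_Suc)
  then show ?case using Suc(1) add \<nu> by metis
qed

lemma finite_bounded_exponents:
  assumes "finite A"
  shows "finite {\<nu> :: nat \<Rightarrow>\<^sub>0 nat. Poly_Mapping.keys \<nu> \<subseteq> A \<and> (\<forall>i. Poly_Mapping.lookup \<nu> i \<le> d)}"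
    (is "finite ?S")
proof (rule finite_imageD)
  show "finite ((\<lambda>\<nu>. restrict (Poly_Mapping.lookup \<nu>) A) ` ?S)"
    by (rule finite_subset[of _ "PiE A (\<lambda>_. {..d})"]) (auto intro!: finite_PiE assms)
  show "inj_on (\<lambda>\<nu>. restrict (Poly_Mapping.lookup \<nu>) A) ?S"
  proof (rule inj_onI, rule poly_mapping_eqI)
    fix \<mu> \<nu> i
    assume *: "\<mu> \<in> ?S" "\<nu> \<in> ?S"
      "restrict (Poly_Mapping.lookup \<mu>) A = restrict (Poly_Mapping.lookup \<nu>) A"
    show "Poly_Mapping.lookup \<mu> i = Poly_Mapping.lookup \<nu> i"
      using *(1,2) fun_cong[OF *(3), of i] by (cases "i \<in> A") (auto simp: in_keys_iff subset_iff, metis gr_zeroI)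
  qed
qed

lemma prod_keys_remove:
  assumes "g k 0 = (1 :: 'a::comm_monoid_mult)"
  shows "(\<Prod>i\<in>Poly_Mapping.keys \<nu>. g i (Poly_Mapping.lookup \<nu> i)) =
    g k (Poly_Mapping.lookup \<nu> k) * (\<Prod>i\<in>Poly_Mapping.keys \<nu> - {k}. g i (Poly_Mapping.lookup \<nu> i))"
  using assms by (cases "k \<in> Poly_Mapping.keys \<nu>") (auto simp: prod.remove in_keys_iff)

text \<open>Together with \<open>prod_keys_remove\<close> this shows how one more unit at k changes
  a product over the support, whether or not k was in it. The recursions for \<open>p_mono\<close>,
  \<open>zexp\<close> and the products of factorials come from here.\<close>

lemma prod_keys_add_single:
  fixes \<nu> :: "nat \<Rightarrow>\<^sub>0 nat"
  shows "(\<Prod>i\<in>Poly_Mapping.keys (Poly_Mapping.single k 1 + \<nu>).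
        g i (Poly_Mapping.lookup (Poly_Mapping.single k 1 + \<nu>) i)) =
    (g k (Suc (Poly_Mapping.lookup \<nu> k)) *
      (\<Prod>i\<in>Poly_Mapping.keys \<nu> - {k}. g i (Poly_Mapping.lookup \<nu> i)) :: 'a::comm_monoid_mult)"
proof -
  have "Poly_Mapping.keys (Poly_Mapping.single k 1 + \<nu>) = insert k (Poly_Mapping.keys \<nu> - {k})"
    by (auto simp: in_keys_iff lookup_add lookup_single when_def split: if_splits)
  then have "(\<Prod>i\<in>Poly_Mapping.keys (Poly_Mapping.single k 1 + \<nu>).
        g i (Poly_Mapping.lookup (Poly_Mapping.single k 1 + \<nu>) i)) =
      g k (Poly_Mapping.lookup (Poly_Mapping.single k 1 + \<nu>) k) *
      (\<Prod>i\<in>Poly_Mapping.keys \<nu> - {k}. g i (Poly_Mapping.lookup (Poly_Mapping.single k 1 + \<nu>) i))"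
    by (simp only:) (rule prod.insert, auto)
  also have "\<dots> = g k (Suc (Poly_Mapping.lookup \<nu> k)) *
      (\<Prod>i\<in>Poly_Mapping.keys \<nu> - {k}. g i (Poly_Mapping.lookup \<nu> i))"
    by (auto simp: lookup_add lookup_single when_def intro!: arg_cong2[where f = "(*)"] prod.cong)
  finally show ?thesis .
qed

text \<open>
  The entry of \<open>part_type \<alpha>\<close> at \<open>i\<close> is the number of parts \<open>i + 1\<close> of the partition obtained by
  sorting \<open>\<alpha>\<close>; this matches the numbering of variables in \<open>eval_p\<close>.
\<close>

definition part_type :: "(nat \<Rightarrow>\<^sub>0 nat) \<Rightarrow> (nat \<Rightarrow>\<^sub>0 nat)" where
  "part_type \<alpha> = Abs_poly_mapping (\<lambda>i. card {j. Poly_Mapping.lookup \<alpha> j = Suc i})"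

lemma finite_fibre: "finite {j. Poly_Mapping.lookup \<alpha> j = Suc i}"
  by (rule finite_subset[OF _ finite_keys[of \<alpha>]]) (auto simp: in_keys_iff)

lemma lookup_part_type:
  "Poly_Mapping.lookup (part_type \<alpha>) i = card {j. Poly_Mapping.lookup \<alpha> j = Suc i}"
proof -
  have "{i. card {j. Poly_Mapping.lookup \<alpha> j = Suc i} \<noteq> 0} \<subseteq>
      (\<lambda>j. Poly_Mapping.lookup \<alpha> j - 1) ` Poly_Mapping.keys \<alpha>"
  proof
    fix i assume "i \<in> {i. card {j. Poly_Mapping.lookup \<alpha> j = Suc i} \<noteq> 0}"
    then have "{j. Poly_Mapping.lookup \<alpha> j = Suc i} \<noteq> {}"
      by (metis (mono_tags, lifting) card.empty mem_Collect_eq)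
    then obtain j where "Poly_Mapping.lookup \<alpha> j = Suc i" by auto
    then show "i \<in> (\<lambda>j. Poly_Mapping.lookup \<alpha> j - 1) ` Poly_Mapping.keys \<alpha>"
      by (intro image_eqI[of _ _ j]) (auto simp: in_keys_iff)
  qed
  then have "finite {i. card {j. Poly_Mapping.lookup \<alpha> j = Suc i} \<noteq> 0}"
    by (rule finite_subset) simp
  then show ?thesis by (simp add: part_type_def)
qed

lemma part_type_0 [simp]: "part_type 0 = 0"
  by (rule poly_mapping_eqI) (simp add: lookup_part_type)

lemma part_type_add_single:
  assumes "Poly_Mapping.lookup \<alpha> j = 0"
  shows "part_type (\<alpha> + Poly_Mapping.single j (Suc k)) = Poly_Mapping.single k 1 + part_type \<alpha>"
proof (rule poly_mapping_eqI)
  fix i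
  have "{l. Poly_Mapping.lookup (\<alpha> + Poly_Mapping.single j (Suc k)) l = Suc i} =
      (if i = k then insert j else id) {l. Poly_Mapping.lookup \<alpha> l = Suc i}"
    using assms by (auto simp: lookup_add lookup_single when_def)
  then show "Poly_Mapping.lookup (part_type (\<alpha> + Poly_Mapping.single j (Suc k))) i =
      Poly_Mapping.lookup (Poly_Mapping.single k 1 + part_type \<alpha>) i"
    using assms by (simp add: lookup_part_type lookup_add lookup_single when_def finite_fibre)
qed

lemma mdeg_part_type: "mdeg (part_type \<alpha>) = card (Poly_Mapping.keys \<alpha>)"
proof (induction \<alpha> rule: update_induct)
  case (update f a b)
  then obtain k where k: "b = Suc k" by (cases b) auto
  have "Poly_Mapping.update a b f = f + Poly_Mapping.single a (Suc k)"
    using update(1) k by (intro poly_mapping_eqI)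
      (auto simp: lookup_update lookup_add lookup_single when_def in_keys_iff)
  moreover from this update(1,2) have
    "card (Poly_Mapping.keys (f + Poly_Mapping.single a (Suc k))) = Suc (card (Poly_Mapping.keys f))"
    by (metis card_insert_disjoint finite_keys keys_update)
  moreover have "part_type (f + Poly_Mapping.single a (Suc k)) = Poly_Mapping.single k 1 + part_type f"
    using update(1) by (intro part_type_add_single) (simp add: in_keys_iff)
  ultimately show ?case
    using update by (simp add: mdeg_add)
qed simp

lemma keys_part_type: "Poly_Mapping.keys (part_type \<alpha>) \<subseteq> {..<mdeg \<alpha>}"
proof
  fix i assume "i \<in> Poly_Mapping.keys (part_type \<alpha>)"
  then have "{j. Poly_Mapping.lookup \<alpha> j = Suc i} \<noteq> {}"
    unfolding in_keys_iff lookup_part_type by (metis card.empty)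
  then obtain j where "Poly_Mapping.lookup \<alpha> j = Suc i" by auto
  then show "i \<in> {..<mdeg \<alpha>}" using lookup_le_mdeg[of \<alpha> j] by simp
qed

lemma part_type_surj: "\<exists>\<alpha>. part_type \<alpha> = \<nu>"
proof (induction \<nu> rule: exponent_induct)
  case zero
  show ?case by (rule exI[of _ 0]) simp
next
  case (add k \<nu>)
  then obtain \<alpha> where \<alpha>: "part_type \<alpha> = \<nu>" by blast
  obtain j where "j \<notin> Poly_Mapping.keys \<alpha>"
    using ex_new_if_finite[OF infinite_UNIV_nat finite_keys] by blast
  then show ?case using part_type_add_single[of \<alpha> j k] \<alpha> by (auto simp: in_keys_iff)
qed

text \<open>On a common finite range of variables the nonzero entries have equal multiplicities, and
  so do the zeros, which fill the remaining places. Equal multisets of entries differ by a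
  permutation of that range, which fixes all other variables.\<close>

lemma part_type_eq_permutation:
  assumes "part_type \<alpha> = part_type \<beta>"
  obtains \<pi> where "bij \<pi>" "\<alpha> = Poly_Mapping.map_key \<pi> \<beta>"
proof -
  obtain N where N: "Poly_Mapping.keys \<alpha> \<union> Poly_Mapping.keys \<beta> \<subseteq> {..<N}"
    using finite_nat_iff_bounded finite_UnI finite_keys by metis
  let ?l = "\<lambda>\<gamma>. map (Poly_Mapping.lookup \<gamma>) [0..<N]"
  have cnt: "count (mset (?l \<gamma>)) (Suc i) = Poly_Mapping.lookup (part_type \<gamma>) i"
    if "Poly_Mapping.keys \<gamma> \<subseteq> {..<N}" for \<gamma> i
  proof -
    have "count (mset (?l \<gamma>)) (Suc i) = card {j. j < N \<and> Poly_Mapping.lookup \<gamma> j = Suc i}"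
      by (simp add: count_mset length_filter_conv_card count_list_eq_length_filter
          del: mset_map) (rule arg_cong[where f = card], auto)
    also have "{j. j < N \<and> Poly_Mapping.lookup \<gamma> j = Suc i} = {j. Poly_Mapping.lookup \<gamma> j = Suc i}"
      using that by (auto simp: subset_iff in_keys_iff)
    finally show ?thesis by (simp add: lookup_part_type)
  qed
  have pos: "filter_mset (\<lambda>x. x \<noteq> 0) (mset (?l \<alpha>)) = filter_mset (\<lambda>x. x \<noteq> 0) (mset (?l \<beta>))"
  proof (rule multiset_eqI)
    fix x show "count (filter_mset (\<lambda>x. x \<noteq> 0) (mset (?l \<alpha>))) x =
        count (filter_mset (\<lambda>x. x \<noteq> 0) (mset (?l \<beta>))) x"
      using cnt[of \<alpha>] cnt[of \<beta>] N assms by (cases x) (auto simp del: mset_map)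
  qed
  moreover have "filter_mset (\<lambda>x. x = 0) (mset (?l \<alpha>)) = filter_mset (\<lambda>x. x = 0) (mset (?l \<beta>))"
  proof -
    have "size (filter_mset (\<lambda>x. x = 0) (mset (?l \<gamma>))) + size (filter_mset (\<lambda>x. x \<noteq> 0) (mset (?l \<gamma>))) = N" for \<gamma>
      unfolding size_union[symmetric] multiset_partition[symmetric] by simp
    from this[of \<alpha>] this[of \<beta>] pos
    have "size (filter_mset (\<lambda>x. x = 0) (mset (?l \<alpha>))) = size (filter_mset (\<lambda>x. x = 0) (mset (?l \<beta>)))"
      by simp
    then show ?thesis
      by (simp add: filter_eq_replicate_mset del: mset_map)
  qed
  ultimately have "mset (?l \<alpha>) = mset (?l \<beta>)"
    by (metis multiset_partition)
  then obtain p where p: "p permutes {..<length (?l \<beta>)}" "permute_list p (?l \<beta>) = ?l \<alpha>"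
    by (rule mset_eq_permutation)
  have bij: "bij p" using p(1) by (rule permutes_bij)
  have "\<alpha> = Poly_Mapping.map_key p \<beta>"
  proof (rule poly_mapping_eqI)
    fix i
    show "Poly_Mapping.lookup \<alpha> i = Poly_Mapping.lookup (Poly_Mapping.map_key p \<beta>) i"
    proof (cases "i < N")
      case True
      then have "p i < N" using permutes_in_image[OF p(1), of i] by simp
      then show ?thesis
        using permute_list_nth[OF p(1), of i] p(2) True by (simp add: lookup_map_key_bij[OF bij])
    next
      case False
      then have "p i = i" using permutes_not_in[OF p(1), of i] by simp
      then show ?thesis
        using N False by (auto simp: lookup_map_key_bij[OF bij] subset_iff in_keys_iff, metis gr_zeroI)
    qed
  qed
  with bij show thesis by (rule that)
qed

section \<open>Symmetric functions as polynomials in the power sums\<close>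

lemma vector_space_symfun_scale: "vector_space (symfun_scale :: 'k::field \<Rightarrow> _)"
  by unfold_locales (transfer; simp add: algebra_simps)+

lemma symfun_scale_mult: "symfun_scale c (f * g) = f * symfun_scale c g"
  by transfer (auto simp: ps_mult_def sum_distrib_left algebra_simps intro!: ext sum.cong)

lemma symfun_coeff_sum: "symfun_coeff (\<Sum>i\<in>A. f i) \<alpha> = (\<Sum>i\<in>A. symfun_coeff (f i) \<alpha>)"
  by (induction A rule: infinite_finite_induct) (simp_all add: zero_symfun.rep_eq plus_symfun.rep_eq)

lemma symfun_coeff_part_type:
  assumes "part_type \<alpha> = part_type \<beta>"
  shows "symfun_coeff f \<alpha> = symfun_coeff f \<beta>"
proof -
  obtain \<pi> where "bij \<pi>" "\<alpha> = Poly_Mapping.map_key \<pi> \<beta>"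
    using assms by (rule part_type_eq_permutation)
  then show ?thesis using symfun_coeff[of f] is_symfun_perm by blast
qed

text \<open>A splitting contributes only if its first part is a power of a single variable. As the
  exponent \<open>Suc k\<close> is positive, different variables give different splittings.\<close>

lemma symfun_coeff_power_sum_mult:
  "symfun_coeff (power_sum (Suc k) * f) \<alpha> =
    (\<Sum>j | Suc k \<le> Poly_Mapping.lookup \<alpha> j. symfun_coeff f (\<alpha> - Poly_Mapping.single j (Suc k)))"
proof -
  let ?J = "{j. Suc k \<le> Poly_Mapping.lookup \<alpha> j}"
  let ?h = "\<lambda>j. (Poly_Mapping.single j (Suc k), \<alpha> - Poly_Mapping.single j (Suc k))"
  let ?t = "\<lambda>(\<beta>, \<gamma>). symfun_coeff (power_sum (Suc k)) \<beta> * symfun_coeff f \<gamma>"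
  have inj: "inj_on ?h ?J"
    by (rule inj_onI) (metis keys_single nat.distinct(1) prod.inject singleton_inject)
  have "symfun_coeff (power_sum (Suc k) * f) \<alpha> = (\<Sum>x\<in>splits \<alpha>. ?t x)"
    by (simp add: times_symfun.rep_eq ps_mult_def)
  also have "\<dots> = (\<Sum>x\<in>?h ` ?J. ?t x)"
  proof (rule sum.mono_neutral_right)
    show "?h ` ?J \<subseteq> splits \<alpha>"
      by (auto simp: splits_def single_add_eq_iff)
    show "\<forall>x\<in>splits \<alpha> - ?h ` ?J. ?t x = 0"
      by (auto simp: splits_def power_sum.rep_eq image_iff)
        (metis add_diff_cancel_left' le_add1 lookup_add lookup_single_eq)
  qed simp
  also have "\<dots> = (\<Sum>j\<in>?J. ?t (?h j))"
    by (rule sum.reindex_cong[OF inj]) auto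
  also have "\<dots> = (\<Sum>j\<in>?J. symfun_coeff f (\<alpha> - Poly_Mapping.single j (Suc k)))"
    by (rule sum.cong) (auto simp: power_sum.rep_eq)
  finally show ?thesis .
qed

section \<open>Triangularity, and free generation by the power sums\<close>

definition p_mono :: "(nat \<Rightarrow>\<^sub>0 nat) \<Rightarrow> 'k::comm_ring_1 symfun" where
  "p_mono \<mu> = (\<Prod>i\<in>Poly_Mapping.keys \<mu>. power_sum (Suc i) ^ Poly_Mapping.lookup \<mu> i)"

lemma p_mono_0 [simp]: "p_mono 0 = 1"
  by (simp add: p_mono_def)

lemma p_mono_add_single: "p_mono (Poly_Mapping.single k 1 + \<mu>) = power_sum (Suc k) * p_mono \<mu>"
  unfolding p_mono_def
    prod_keys_add_single[where g = "\<lambda>i n. power_sum (Suc i) ^ n"]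
    prod_keys_remove[where g = "\<lambda>i n. power_sum (Suc i) ^ n" and k = k and \<nu> = \<mu>, OF power_0]
  by (simp add: mult.assoc)

text \<open>A new factor \<open>power_sum (Suc k)\<close> takes the power k + 1 of some variable j
  out of \<alpha>. If the variable survives, the number of variables stays and is too large for
  \<open>p_mono \<nu>\<close>; if it disappears, the type loses one part k + 1. In the top case with
  matching type there are \<open>Suc (lookup \<nu> k)\<close> such j, and this number extends the
  product of factorials. Vanishing is proved in the same induction because the top case calls on
  it.\<close>

lemma coeff_p_mono:
  "(mdeg \<nu> < card (Poly_Mapping.keys \<alpha>) \<longrightarrow> symfun_coeff (p_mono \<nu>) \<alpha> = (0 :: 'k::comm_ring_1)) \<and>
   (card (Poly_Mapping.keys \<alpha>) = mdeg \<nu> \<longrightarrow> symfun_coeff (p_mono \<nu>) \<alpha> =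
     (if part_type \<alpha> = \<nu> then of_nat (\<Prod>i\<in>Poly_Mapping.keys \<nu>. fact (Poly_Mapping.lookup \<nu> i))
      else 0 :: 'k))"
proof (induction \<nu> arbitrary: \<alpha> rule: exponent_induct)
  case zero
  show ?case by (auto simp: one_symfun.rep_eq)
next
  case (add k \<nu>)
  let ?\<nu> = "Poly_Mapping.single k 1 + \<nu>"
  let ?r = "\<lambda>j. \<alpha> - Poly_Mapping.single j (Suc k)"
  let ?f = "\<lambda>\<nu>. \<Prod>i\<in>Poly_Mapping.keys \<nu>. fact (Poly_Mapping.lookup \<nu> i) :: nat"
  let ?J = "{j. Suc k \<le> Poly_Mapping.lookup \<alpha> j}" and ?E = "{j. Poly_Mapping.lookup \<alpha> j = Suc k}"
  have finJ: "finite ?J"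
    by (rule finite_subset[OF _ finite_keys[of \<alpha>]]) (auto simp: in_keys_iff)
  have coeff: "symfun_coeff (p_mono ?\<nu>) \<alpha> = (\<Sum>j\<in>?J. symfun_coeff (p_mono \<nu>) (?r j) :: 'k)"
    by (simp only: p_mono_add_single symfun_coeff_power_sum_mult)
  have keys_big: "Poly_Mapping.keys (?r j) = Poly_Mapping.keys \<alpha>" if "j \<in> ?J - ?E" for j
    using that by (auto simp: in_keys_iff lookup_minus lookup_single when_def)
  have keys_eq: "card (Poly_Mapping.keys \<alpha>) = Suc (card (Poly_Mapping.keys (?r j)))" if "j \<in> ?E" for j
  proof -
    have "Poly_Mapping.keys (?r j) = Poly_Mapping.keys \<alpha> - {j}"
      using that by (auto simp: in_keys_iff lookup_minus lookup_single when_def split: if_splits)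
    moreover have "j \<in> Poly_Mapping.keys \<alpha>" using that by (simp add: in_keys_iff)
    ultimately show ?thesis by (metis card_Suc_Diff1 finite_keys)
  qed
  have type_eq: "part_type \<alpha> = Poly_Mapping.single k 1 + part_type (?r j)" if "j \<in> ?E" for j
  proof -
    have "?r j + Poly_Mapping.single j (Suc k) = \<alpha>"
      using that single_add_eq_iff[of j "Suc k" "?r j" \<alpha>] by (simp add: add.commute)
    moreover have "Poly_Mapping.lookup (?r j) j = 0"
      using that by (simp add: lookup_minus)
    ultimately show ?thesis using part_type_add_single[of "?r j" j k] by simp
  qed
  have "symfun_coeff (p_mono ?\<nu>) \<alpha> = (0 :: 'k)" if "mdeg ?\<nu> < card (Poly_Mapping.keys \<alpha>)"
  proof -
    have "symfun_coeff (p_mono \<nu>) (?r j) = (0 :: 'k)" if "j \<in> ?J" for j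
      using add[of "?r j"] keys_big[of j] keys_eq[of j] that \<open>mdeg ?\<nu> < _\<close>
      by (cases "j \<in> ?E") (auto simp: mdeg_add)
    then show ?thesis unfolding coeff by (intro sum.neutral) blast
  qed
  moreover have "symfun_coeff (p_mono ?\<nu>) \<alpha> =
      (if part_type \<alpha> = ?\<nu> then of_nat (?f ?\<nu>) else 0 :: 'k)"
    if "card (Poly_Mapping.keys \<alpha>) = mdeg ?\<nu>"
  proof -
    have "symfun_coeff (p_mono ?\<nu>) \<alpha> = (\<Sum>j\<in>?E. symfun_coeff (p_mono \<nu>) (?r j) :: 'k)"
      unfolding coeff
    proof (rule sum.mono_neutral_right[OF finJ])
      show "\<forall>j\<in>?J - ?E. symfun_coeff (p_mono \<nu>) (?r j) = (0 :: 'k)"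
        using add keys_big that by (simp add: mdeg_add)
    qed auto
    also have "\<dots> = (\<Sum>j\<in>?E. if part_type \<alpha> = ?\<nu> then of_nat (?f \<nu>) else 0)"
    proof (rule sum.cong[OF refl])
      fix j assume j: "j \<in> ?E"
      from that keys_eq[OF j] have "card (Poly_Mapping.keys (?r j)) = mdeg \<nu>"
        by (simp add: mdeg_add)
      with add[of "?r j"] type_eq[OF j]
      show "symfun_coeff (p_mono \<nu>) (?r j) = (if part_type \<alpha> = ?\<nu> then of_nat (?f \<nu>) else 0 :: 'k)"
        by (auto simp del: of_nat_prod)
    qed
    also have "\<dots> = (if part_type \<alpha> = ?\<nu> then of_nat (card ?E * ?f \<nu>) else 0)"
      by simp
    also have "\<dots> = (if part_type \<alpha> = ?\<nu> then of_nat (?f ?\<nu>) else 0)"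
    proof (rule if_cong[OF refl _ refl])
      assume "part_type \<alpha> = ?\<nu>"
      then have "card ?E = Suc (Poly_Mapping.lookup \<nu> k)"
        using lookup_part_type[of \<alpha> k] by (simp add: lookup_add)
      then have "card ?E * ?f \<nu> = ?f ?\<nu>"
        unfolding prod_keys_add_single[where g = "\<lambda>_. fact"]
        by (subst prod_keys_remove[of _ k]) (simp_all add: algebra_simps)
      then show "(of_nat (card ?E * ?f \<nu>) :: 'k) = of_nat (?f ?\<nu>)" by (rule arg_cong)
    qed
    finally show ?thesis .
  qed
  ultimately show ?case by blast
qed

lemma eval_p_single: "eval_p (Poly_Mapping.single \<mu> c) = symfun_scale c (p_mono \<mu>)"
proof (cases "c = 0")
  case True
  have "symfun_scale 0 f = 0" for f :: "'a symfun" by transfer simp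
  with True show ?thesis by (simp add: eval_p_def)
qed (simp add: eval_p_def p_mono_def)

lemma eval_p_add: "eval_p (P + Q) = eval_p P + eval_p Q"
proof -
  have "symfun_scale 0 f = 0" "symfun_scale (c + d) f = symfun_scale c f + symfun_scale d f"
    for c d and f :: "'a symfun"
    by (transfer; simp add: algebra_simps)+
  then show ?thesis unfolding eval_p_def by (intro setsum_keys_plus_distrib) auto
qed

lemma eval_p_0 [simp]: "eval_p 0 = 0"
  by (simp add: eval_p_def)

lemma eval_p_diff: "eval_p (P - Q) = eval_p P - eval_p Q"
  using eval_p_add[of "P - Q" Q] by (simp add: eq_diff_eq)

lemma coeff_eval_p:
  "symfun_coeff (eval_p P) \<alpha> =
    (\<Sum>\<mu>\<in>Poly_Mapping.keys P. Poly_Mapping.lookup P \<mu> * symfun_coeff (p_mono \<mu>) \<alpha>)"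
  by (simp add: eval_p_def p_mono_def symfun_coeff_sum symfun_scale.rep_eq)

text \<open>Take \<mu> in the support with the most factors and \<alpha> of type \<mu>. Then
  \<alpha> has as many variables as \<mu> has factors, so by triangularity \<mu> alone contributes
  at \<alpha>, and its factorials are nonzero in characteristic 0.\<close>

lemma eval_p_eq_0D:
  assumes "eval_p P = (0 :: 'k::field_char_0 symfun)"
  shows "P = 0"
proof (rule ccontr)
  assume "P \<noteq> 0"
  then have ne: "Poly_Mapping.keys P \<noteq> {}"
    by (metis empty_iff in_keys_iff lookup_zero poly_mapping_eqI)
  then have "Max (mdeg ` Poly_Mapping.keys P) \<in> mdeg ` Poly_Mapping.keys P"
    by (intro Max_in) auto
  then obtain \<mu> where \<mu>: "\<mu> \<in> Poly_Mapping.keys P" "Max (mdeg ` Poly_Mapping.keys P) = mdeg \<mu>"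
    by auto
  have max: "mdeg \<nu> \<le> mdeg \<mu>" if "\<nu> \<in> Poly_Mapping.keys P" for \<nu>
    unfolding \<mu>(2)[symmetric] using that by (intro Max_ge) auto
  obtain \<alpha> where \<alpha>: "part_type \<alpha> = \<mu>" using part_type_surj by blast
  let ?f = "of_nat (\<Prod>i\<in>Poly_Mapping.keys \<mu>. fact (Poly_Mapping.lookup \<mu> i)) :: 'k"
  have "symfun_coeff (eval_p P) \<alpha> = (\<Sum>\<nu>\<in>Poly_Mapping.keys P. if \<nu> = \<mu> then Poly_Mapping.lookup P \<mu> * ?f else 0)"
    unfolding coeff_eval_p
  proof (rule sum.cong[OF refl])
    fix \<nu> assume "\<nu> \<in> Poly_Mapping.keys P"
    then show "Poly_Mapping.lookup P \<nu> * symfun_coeff (p_mono \<nu>) \<alpha> =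
        (if \<nu> = \<mu> then Poly_Mapping.lookup P \<mu> * ?f else 0)"
      using max[of \<nu>] \<alpha> mdeg_part_type[of \<alpha>] coeff_p_mono[of \<nu> \<alpha>, where 'k = 'k]
      by (cases "mdeg \<nu> = mdeg \<mu>") auto
  qed
  also have "\<dots> = Poly_Mapping.lookup P \<mu> * ?f"
    using \<mu>(1) by simp
  finally show False
    using \<mu>(1) assms by (simp add: zero_symfun.rep_eq in_keys_iff)
qed

text \<open>Induction on a strict bound for the number of variables in a monomial: a combination Q
  of products of r power sums cancels all monomials in exactly r variables and creates none in more.
  Bounded degree keeps the set T of types finite.\<close>

lemma eval_p_surj: "\<exists>P. eval_p P = (f :: 'k::field_char_0 symfun)"
proof -
  obtain d where d: "\<And>\<alpha>. symfun_coeff f \<alpha> \<noteq> 0 \<Longrightarrow> mdeg \<alpha> \<le> d"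
    using symfun_coeff[of f] is_symfun_bounded by blast
  have "\<exists>P. eval_p P = g"
    if "\<And>\<alpha>. symfun_coeff g \<alpha> \<noteq> 0 \<Longrightarrow> card (Poly_Mapping.keys \<alpha>) < r" for r and g :: "'k symfun"
    using that
  proof (induction r arbitrary: g)
    case 0
    then have "g = 0"
      by (intro symfun_coeff_inject[THEN iffD1] ext) (auto simp: zero_symfun.rep_eq)
    then show ?case using eval_p_0 by metis
  next
    case (Suc r)
    obtain d where d: "\<And>\<alpha>. symfun_coeff g \<alpha> \<noteq> 0 \<Longrightarrow> mdeg \<alpha> \<le> d"
      using symfun_coeff[of g] is_symfun_bounded by blast
    define T where "T = part_type ` {\<alpha>. symfun_coeff g \<alpha> \<noteq> 0 \<and> card (Poly_Mapping.keys \<alpha>) = r}"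
    have finT: "finite T"
    proof (rule finite_subset[OF _ finite_bounded_exponents[OF finite_lessThan[of d]]])
      show "T \<subseteq> {\<nu>. Poly_Mapping.keys \<nu> \<subseteq> {..<d} \<and> (\<forall>i. Poly_Mapping.lookup \<nu> i \<le> r)}"
        using d keys_part_type lookup_le_mdeg[of "part_type _"]
        by (fastforce simp: T_def mdeg_part_type)
    qed
    let ?f = "\<lambda>\<nu>. of_nat (\<Prod>i\<in>Poly_Mapping.keys \<nu>. fact (Poly_Mapping.lookup \<nu> i)) :: 'k"
    \<comment> \<open>Divides by the leading coefficient from \<open>coeff_p_mono\<close>. The
      choice of \<alpha> does not matter, since a symmetric function has equal coefficients at
      vectors of one type.\<close>
    define c where "c \<nu> = symfun_coeff g (SOME \<alpha>. part_type \<alpha> = \<nu>) / ?f \<nu>" for \<nu>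
    have c: "c (part_type \<alpha>) * ?f (part_type \<alpha>) = symfun_coeff g \<alpha>" for \<alpha>
    proof -
      have "symfun_coeff g (SOME \<beta>. part_type \<beta> = part_type \<alpha>) = symfun_coeff g \<alpha>"
        by (rule symfun_coeff_part_type) (metis (mono_tags) someI)
      then show ?thesis by (simp add: c_def)
    qed
    define Q where "Q = (\<Sum>\<nu>\<in>T. Poly_Mapping.single \<nu> (c \<nu>))"
    have "eval_p Q = (\<Sum>\<nu>\<in>T. symfun_scale (c \<nu>) (p_mono \<nu>))"
      unfolding Q_def using finT by (induction T rule: finite_induct) (simp_all add: eval_p_add eval_p_single)
    then have Q: "symfun_coeff (eval_p Q) \<alpha> = (\<Sum>\<nu>\<in>T. c \<nu> * symfun_coeff (p_mono \<nu>) \<alpha>)" for \<alpha>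
      by (simp add: symfun_coeff_sum symfun_scale.rep_eq)
    have degT: "mdeg \<nu> = r" if "\<nu> \<in> T" for \<nu>
      using that by (auto simp: T_def mdeg_part_type)
    have "\<exists>P. eval_p P = g - eval_p Q"
    proof (rule Suc.IH, rule ccontr)
      fix \<alpha>
      assume nz: "symfun_coeff (g - eval_p Q) \<alpha> \<noteq> 0" and "\<not> card (Poly_Mapping.keys \<alpha>) < r"
      then consider "card (Poly_Mapping.keys \<alpha>) = r" | "card (Poly_Mapping.keys \<alpha>) > r" by linarith
      then have "symfun_coeff (eval_p Q) \<alpha> = symfun_coeff g \<alpha>"
      proof cases
        case 1
        have "symfun_coeff (eval_p Q) \<alpha> =
            (\<Sum>\<nu>\<in>T. if \<nu> = part_type \<alpha> then symfun_coeff g \<alpha> else 0)"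
          unfolding Q
        proof (rule sum.cong[OF refl])
          fix \<nu> assume "\<nu> \<in> T"
          then show "c \<nu> * symfun_coeff (p_mono \<nu>) \<alpha> = (if \<nu> = part_type \<alpha> then symfun_coeff g \<alpha> else 0)"
            using coeff_p_mono[of \<nu> \<alpha>, where 'k = 'k] degT 1 c[of \<alpha>] by auto
        qed
        also have "\<dots> = symfun_coeff g \<alpha>"
          using finT 1 by (auto simp: T_def)
        finally show ?thesis .
      next
        case 2
        then have "symfun_coeff g \<alpha> = 0" using Suc.prems[of \<alpha>] by fastforce
        moreover have "symfun_coeff (eval_p Q) \<alpha> = 0"
          unfolding Q using 2 degT coeff_p_mono[where \<alpha> = \<alpha> and 'k = 'k]
          by (intro sum.neutral) auto
        ultimately show ?thesis by simp
      qed
      with nz show False by (simp add: minus_symfun.rep_eq)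
    qed
    then obtain P where "eval_p P = g - eval_p Q" by blast
    then have "eval_p (P + Q) = g" by (simp add: eval_p_add)
    then show ?case by blast
  qed
  \<comment> \<open>A monomial has at most as many variables as its degree, so the degree bound of f
    yields the bound that the induction asks for.\<close>
  moreover have "card (Poly_Mapping.keys \<alpha>) < Suc d" if "symfun_coeff f \<alpha> \<noteq> 0" for \<alpha>
  proof -
    have "card (Poly_Mapping.keys \<alpha>) \<le> mdeg \<alpha>"
      unfolding mdeg_def using sum_mono[of "Poly_Mapping.keys \<alpha>" "\<lambda>_. 1" "Poly_Mapping.lookup \<alpha>"]
      by (auto simp: in_keys_iff Suc_le_eq)
    then show ?thesis using d[OF that] by simp
  qed
  ultimately show ?thesis by blast
qed

section \<open>The Fock representation on symmetric functions\<close>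

text \<open>Otherwise the simplifier turns \<open>single k 1\<close> into a form that the rules below do not match.\<close>

declare One_nat_def [simp del]

section \<open>Partial derivatives of polynomials in the power sums\<close>

lemma lookup_const_mult:
  "Poly_Mapping.lookup (Poly_Mapping.single 0 c * P) \<mu> = c * Poly_Mapping.lookup P \<mu>"
  for P :: "(nat \<Rightarrow>\<^sub>0 nat) \<Rightarrow>\<^sub>0 'k::comm_ring_1"
  by (simp add: mult_map_scale_conv_mult[symmetric] Poly_Mapping.map.rep_eq when_def)

lemma lookup_var_mult:
  "Poly_Mapping.lookup (Poly_Mapping.single (Poly_Mapping.single k 1) 1 * P) \<mu> =
    (if Poly_Mapping.lookup \<mu> k = 0 then 0 else Poly_Mapping.lookup P (\<mu> - Poly_Mapping.single k 1))"
  for P :: "(nat \<Rightarrow>\<^sub>0 nat) \<Rightarrow>\<^sub>0 'k::comm_ring_1"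
proof (induction P rule: poly_mapping_add_induct)
  case (single \<nu> c)
  show ?case
    using single_add_eq_iff[of k 1 \<nu> \<mu>]
    by (auto simp: mult_single lookup_single when_def)
qed (simp add: distrib_left lookup_add)

lemma pderiv_var_add: "pderiv_var i (P + Q) = pderiv_var i P + pderiv_var i Q"
  unfolding pderiv_var_def
  by (rule setsum_keys_plus_distrib) (simp_all add: distrib_left single_add)

lemma pderiv_var_single:
  "pderiv_var i (Poly_Mapping.single \<mu> c) =
    Poly_Mapping.single (\<mu> - Poly_Mapping.single i 1) (of_nat (Poly_Mapping.lookup \<mu> i) * c)"
  by (cases "c = 0") (simp_all add: pderiv_var_def)

text \<open>Only the term at \<mu> plus one unit at i is sent to \<mu>: a term free of variable i,
  which truncated subtraction leaves in place, carries the factor 0.\<close>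

lemma lookup_pderiv_var:
  "Poly_Mapping.lookup (pderiv_var i P) \<mu> =
    of_nat (Suc (Poly_Mapping.lookup \<mu> i)) * Poly_Mapping.lookup P (Poly_Mapping.single i 1 + \<mu>)"
proof (induction P rule: poly_mapping_add_induct)
  case (single \<nu> c)
  have "Poly_Mapping.single i 1 + \<mu> = \<nu> \<longleftrightarrow>
      1 \<le> Poly_Mapping.lookup \<nu> i \<and> \<mu> = \<nu> - Poly_Mapping.single i 1"
    by (rule single_add_eq_iff)
  then show ?case
    by (cases "Poly_Mapping.lookup \<nu> i = 0")
      (auto simp: pderiv_var_single lookup_single when_def lookup_minus lookup_add)
qed (simp add: pderiv_var_add lookup_add distrib_left)

lemma minus_single_add_commute:
  assumes "0 < Poly_Mapping.lookup \<mu> k"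
  shows "\<nu> + \<mu> - Poly_Mapping.single k 1 = \<nu> + (\<mu> - Poly_Mapping.single k (1::nat))"
  using assms by (intro poly_mapping_eqI) (auto simp: lookup_add lookup_minus lookup_single when_def)

lemma pderiv_var_commute: "pderiv_var i (pderiv_var j P) = pderiv_var j (pderiv_var i P)"
  by (rule poly_mapping_eqI)
    (auto simp: lookup_pderiv_var lookup_add lookup_single when_def add.left_commute mult.left_commute)

text \<open>The Leibniz rule for one variable, by comparing coefficients; the case split keeps
  truncated subtraction away from exponent 0.\<close>

lemma pderiv_var_var_mult:
  "pderiv_var i (Poly_Mapping.single (Poly_Mapping.single k 1) 1 * P) =
    Poly_Mapping.single (Poly_Mapping.single k 1) 1 * pderiv_var i P + (if i = k then P else 0)"
  for P :: "(nat \<Rightarrow>\<^sub>0 nat) \<Rightarrow>\<^sub>0 'k::comm_ring_1"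
proof (rule poly_mapping_eqI)
  fix \<mu> :: "nat \<Rightarrow>\<^sub>0 nat"
  show "Poly_Mapping.lookup (pderiv_var i (Poly_Mapping.single (Poly_Mapping.single k 1) 1 * P)) \<mu> =
    Poly_Mapping.lookup (Poly_Mapping.single (Poly_Mapping.single k 1) 1 * pderiv_var i P +
      (if i = k then P else 0)) \<mu>"
  proof (cases "Poly_Mapping.lookup \<mu> k = 0")
    case True
    then show ?thesis
      by (auto simp: lookup_pderiv_var lookup_var_mult lookup_add lookup_single when_def)
  next
    case False
    then have "Poly_Mapping.single k 1 + (\<mu> - Poly_Mapping.single k 1) = \<mu>"
      using single_add_eq_iff[of k 1 _ \<mu>] by simp
    then show ?thesis
      using False minus_single_add_commute[of \<mu> k "Poly_Mapping.single i 1"]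
      by (auto simp: lookup_pderiv_var lookup_var_mult lookup_add lookup_single lookup_minus
          when_def distrib_right left_diff_distrib)
  qed
qed

lemma eval_p_var_mult:
  "eval_p (Poly_Mapping.single (Poly_Mapping.single k 1) 1 * P) = power_sum (Suc k) * eval_p P"
  for P :: "(nat \<Rightarrow>\<^sub>0 nat) \<Rightarrow>\<^sub>0 'k::comm_ring_1"
proof (induction P rule: poly_mapping_add_induct)
  case (single \<nu> c)
  show ?case
    by (simp add: mult_single eval_p_single p_mono_add_single symfun_scale_mult)
qed (simp add: distrib_left eval_p_add)

lemma eval_p_const_mult: "eval_p (Poly_Mapping.single 0 c * P) = symfun_scale c (eval_p P)"
  for P :: "(nat \<Rightarrow>\<^sub>0 nat) \<Rightarrow>\<^sub>0 'k::comm_ring_1"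
proof (induction P rule: poly_mapping_add_induct)
  case (single \<nu> d)
  have "symfun_scale (c * d) f = symfun_scale c (symfun_scale d f)" for f :: "'k symfun"
    by transfer (simp add: mult.assoc)
  then show ?case by (simp add: mult_single eval_p_single)
next
  case (add P Q)
  have "symfun_scale c (f + g) = symfun_scale c f + symfun_scale c g" for f g :: "'k symfun"
    by transfer (simp add: distrib_left)
  with add show ?case by (simp add: distrib_left eval_p_add)
qed

text \<open>Injectivity of \<open>eval_p\<close> makes the definite description in
  \<open>deriv_p\<close> return P.\<close>

lemma deriv_p_eval_p:
  "deriv_p (Suc k) (eval_p P) = (eval_p (pderiv_var k P) :: 'k::field_char_0 symfun)"
proof -
  have "(THE Q. eval_p Q = eval_p P) = P"
  proof (rule the_equality)
    fix Q assume "eval_p Q = eval_p P"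
    then have "eval_p (Q - P) = 0" by (simp add: eval_p_diff)
    then have "Q - P = 0" by (rule eval_p_eq_0D)
    then show "Q = P" by simp
  qed simp
  then show ?thesis by (simp add: deriv_p_def)
qed

text \<open>Surjectivity of \<open>eval_p\<close> lets the arguments be polynomials, where the claim
  is seen on coefficients. The next two lemmas take the same route.\<close>

lemma deriv_p_linear:
  assumes "k > 0"
  shows "Vector_Spaces.linear symfun_scale symfun_scale (deriv_p k :: 'k::field_char_0 symfun \<Rightarrow> _)"
proof -
  interpret vector_space "symfun_scale :: 'k \<Rightarrow> _" by (rule vector_space_symfun_scale)
  obtain i where k: "k = Suc i" using assms gr0_implies_Suc by blast
  show ?thesis
  proof unfold_locales
    fix f g :: "'k symfun" and c :: 'k
    obtain P Q where f: "f = eval_p P" and g: "g = eval_p Q" using eval_p_surj by metis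
    show "deriv_p k (f + g) = deriv_p k f + deriv_p k g"
      unfolding f g k eval_p_add[symmetric] deriv_p_eval_p pderiv_var_add ..
    have "pderiv_var i (Poly_Mapping.single 0 c * P) = Poly_Mapping.single 0 c * pderiv_var i P"
      by (rule poly_mapping_eqI) (simp add: lookup_pderiv_var lookup_const_mult mult.left_commute)
    then show "deriv_p k (symfun_scale c f) = symfun_scale c (deriv_p k f)"
      unfolding f k eval_p_const_mult[symmetric] deriv_p_eval_p by simp
  qed
qed

lemma deriv_p_commute:
  assumes "k > 0" "l > 0"
  shows "deriv_p k (deriv_p l f) = deriv_p l (deriv_p k (f :: 'k::field_char_0 symfun))"
proof -
  obtain P where f: "f = eval_p P" using eval_p_surj by metis
  obtain i j where "k = Suc i" "l = Suc j" using assms gr0_implies_Suc by blast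
  then show ?thesis
    unfolding f by (simp add: deriv_p_eval_p pderiv_var_commute)
qed

lemma deriv_p_power_sum_mult:
  assumes "k > 0" "l > 0"
  shows "deriv_p k (power_sum l * f) =
    power_sum l * deriv_p k f + (if k = l then f else 0 :: 'k::field_char_0 symfun)"
proof -
  obtain P where f: "f = eval_p P" using eval_p_surj by metis
  obtain i j where "k = Suc i" "l = Suc j" using assms gr0_implies_Suc by blast
  then show ?thesis
    by (cases "i = j")
      (simp_all add: f eval_p_var_mult[symmetric] deriv_p_eval_p pderiv_var_var_mult eval_p_add)
qed

text \<open>Multiplications commute among themselves and so do derivatives; the Leibniz rule leaves
  only scalars as commutators of opposite indices. Hence \<open>heis_rep_of_operators\<close>
  applies.\<close>

lemma fock_rep_exists:
  fixes a :: "int \<Rightarrow> 'k::field_char_0"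
  assumes a_sym: "\<And>k. k \<noteq> 0 \<Longrightarrow> a k = a (- k)"
  obtains \<sigma> where "heis_rep symfun_scale a \<sigma>"
    "\<And>k f. k \<ge> 1 \<Longrightarrow> \<sigma> (heis_B a (- int k)) f = symfun_scale (a (int k)) (power_sum k * f)"
    "\<And>k f. k \<ge> 1 \<Longrightarrow> \<sigma> (heis_B a (int k)) f = symfun_scale (of_nat k) (deriv_p k f)"
proof -
  interpret vector_space "symfun_scale :: 'k \<Rightarrow> _" by (rule vector_space_symfun_scale)
  interpret vector_space_pair "symfun_scale :: 'k \<Rightarrow> _" "symfun_scale :: 'k \<Rightarrow> _" by unfold_locales
  define B :: "int \<Rightarrow> 'k symfun \<Rightarrow> 'k symfun" where
    "B k = (if k > 0 then (\<lambda>f. symfun_scale (of_nat (nat k)) (deriv_p (nat k) f))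
      else (\<lambda>f. symfun_scale (a (- k)) (power_sum (nat (- k)) * f)))" for k
  have scale_mult: "g * symfun_scale c f = symfun_scale c (g * f)" for g f :: "'k symfun" and c
    by (simp add: symfun_scale_mult)
  have deriv_scale: "k > 0 \<Longrightarrow> deriv_p k (symfun_scale c f) = symfun_scale c (deriv_p k f)"
    for k c and f :: "'k symfun"
    using linear_scale[OF deriv_p_linear] by blast
  have lin: "Vector_Spaces.linear symfun_scale symfun_scale (B k)" if "k \<noteq> 0" for k
  proof (cases "k > 0")
    case True
    then show ?thesis
      using linear_compose_scale_right[OF deriv_p_linear[of "nat k"]] by (simp add: B_def)
  next
    case False
    then show ?thesis
      by unfold_locales (simp_all add: B_def scale_mult distrib_left scale_right_distrib scale_left_commute)
  qed
  have rel: "B k (B l f) - B l (B k f) = (if k = - l then symfun_scale (of_int k * a k) f else 0)"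
    if "k \<noteq> 0" "l \<noteq> 0" for k l f
  proof -
    have pos: "B (int i) f = symfun_scale (of_nat i) (deriv_p i f)" if "i > 0" for i f
      using that by (simp add: B_def)
    have neg: "B (- int i) f = symfun_scale (a (int i)) (power_sum i * f)" for i f
      by (simp add: B_def)
    have mixed: "B (int i) (B (- int j) f) =
        B (- int j) (B (int i) f) + (if i = j then symfun_scale (of_nat i * a (int i)) f else 0)"
      if "i > 0" "j > 0" for i j f
      using that
      by (simp add: pos neg deriv_scale scale_mult deriv_p_power_sum_mult scale_right_distrib
          mult.commute[of "a (int j)"])
    obtain i j where "i > 0" "j > 0" "k = int i \<or> k = - int i" "l = int j \<or> l = - int j"
      using \<open>k \<noteq> 0\<close> \<open>l \<noteq> 0\<close> by (metis int_cases2 of_nat_0 minus_zero gr0I)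
    then consider "k = int i" "l = int j" | "k = int i" "l = - int j"
      | "k = - int i" "l = int j" | "k = - int i" "l = - int j" by blast
    then show ?thesis
    proof cases
      case 1
      with \<open>i > 0\<close> \<open>j > 0\<close> show ?thesis
        by (simp add: pos deriv_scale deriv_p_commute[of i] mult.commute)
    next
      case 2
      with \<open>i > 0\<close> \<open>j > 0\<close> show ?thesis by (simp add: mixed)
    next
      \<comment> \<open>Here the symmetry of \<open>a\<close> enters: exchanging the operators gives
        the scalar - j * a j, whereas the relation for the index - j asks for (- j) * a (-
        j).\<close>
      case 3
      with \<open>i > 0\<close> \<open>j > 0\<close> show ?thesis by (auto simp: mixed a_sym[of "int j"])
    next
      case 4
      then show ?thesis
        by (simp add: neg scale_mult mult.left_commute mult.commute[of "a (int i)"])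
    qed
  qed
  obtain \<sigma> where "heis_rep symfun_scale a \<sigma>" "\<And>k. k \<noteq> 0 \<Longrightarrow> \<sigma> (heis_B a k) = B k"
    using heis_rep_of_operators[OF vector_space_symfun_scale lin rel] by blast
  then show thesis by (intro that[of \<sigma>]) (auto simp: B_def)
qed

section \<open>Partitions as exponent vectors\<close>

text \<open>With entry i counting the parts i + 1, this is the size of the partition, and
  \<open>zexp\<close> is its number z.\<close>

definition wt :: "(nat \<Rightarrow>\<^sub>0 nat) \<Rightarrow> nat" where
  "wt \<nu> = (\<Sum>i\<in>Poly_Mapping.keys \<nu>. Suc i * Poly_Mapping.lookup \<nu> i)"

definition zexp :: "(nat \<Rightarrow>\<^sub>0 nat) \<Rightarrow> nat" where
  "zexp \<nu> = (\<Prod>i\<in>Poly_Mapping.keys \<nu>. Suc i ^ Poly_Mapping.lookup \<nu> i * fact (Poly_Mapping.lookup \<nu> i))"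

text \<open>The index is \<open>x - 1\<close> because entry i counts the parts i + 1. A part 0 would
  be counted as a part 1, hence the condition \<open>0 \<notin> set xs\<close> in the lemmas
  below.\<close>

definition part_exp :: "nat list \<Rightarrow> (nat \<Rightarrow>\<^sub>0 nat)" where
  "part_exp xs = (\<Sum>x\<leftarrow>xs. Poly_Mapping.single (x - 1) 1)"

lemma wt_0 [simp]: "wt 0 = 0"
  by (simp add: wt_def)

lemma wt_add: "wt (\<mu> + \<nu>) = wt \<mu> + wt \<nu>"
  unfolding wt_def by (rule setsum_keys_plus_distrib) (simp_all add: algebra_simps)

lemma wt_single [simp]: "wt (Poly_Mapping.single k n) = Suc k * n"
  by (cases "n = 0") (simp_all add: wt_def)

lemma zexp_0 [simp]: "zexp 0 = 1"
  by (simp add: zexp_def)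

lemma zexp_neq_0 [simp]: "zexp \<nu> \<noteq> 0"
  by (simp add: zexp_def)

text \<open>The two new factors are those that differentiation and \<open>Wop\<close> produce;
  dividing by \<open>zexp\<close> cancels them.\<close>

lemma zexp_add_single:
  "zexp (Poly_Mapping.single k 1 + \<nu>) = Suc k * Suc (Poly_Mapping.lookup \<nu> k) * zexp \<nu>"
  unfolding zexp_def prod_keys_add_single[where g = "\<lambda>i n. Suc i ^ n * fact n"]
  by (subst prod_keys_remove[where g = "\<lambda>i n. Suc i ^ n * fact n" and k = k]) (simp_all add: algebra_simps)

lemma finite_wt: "finite {\<nu>. wt \<nu> = n}"
proof (rule finite_subset[OF _ finite_bounded_exponents[OF finite_lessThan[of n]]])
  have le: "Suc i * Poly_Mapping.lookup \<nu> i \<le> wt \<nu>" for \<nu> i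
  proof (cases "i \<in> Poly_Mapping.keys \<nu>")
    case True
    then show ?thesis
      unfolding wt_def by (rule member_le_sum[where f = "\<lambda>i. Suc i * Poly_Mapping.lookup \<nu> i"]) simp_all
  qed (simp add: in_keys_iff)
  have bound: "y \<le> n \<and> (y \<noteq> 0 \<longrightarrow> i < n)" if "Suc i * y \<le> n" for i y
    using that by (cases y) auto
  have "Poly_Mapping.lookup \<nu> i \<le> n \<and> (Poly_Mapping.lookup \<nu> i \<noteq> 0 \<longrightarrow> i < n)" if "wt \<nu> = n" for \<nu> i
    using bound le[of i \<nu>] that by simp
  then show "{\<nu>. wt \<nu> = n} \<subseteq>
      {\<nu>. Poly_Mapping.keys \<nu> \<subseteq> {..<n} \<and> (\<forall>i. Poly_Mapping.lookup \<nu> i \<le> n)}"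
    unfolding in_keys_iff subset_iff by blast
qed

lemma part_exp_Cons: "part_exp (x # xs) = Poly_Mapping.single (x - 1) 1 + part_exp xs"
  by (simp add: part_exp_def)

lemma part_exp_Nil [simp]: "part_exp [] = 0"
  by (simp add: part_exp_def)

lemma lookup_part_exp:
  "0 \<notin> set xs \<Longrightarrow> Poly_Mapping.lookup (part_exp xs) i = count_list xs (Suc i)"
  by (induction xs) (auto simp: part_exp_Cons lookup_add lookup_single when_def)

lemma wt_part_exp: "0 \<notin> set xs \<Longrightarrow> wt (part_exp xs) = sum_list xs"
  by (induction xs) (auto simp: part_exp_Cons wt_add)

lemma zee_part_exp:
  assumes "0 \<notin> set xs"
  shows "zee xs = zexp (part_exp xs)"
proof -
  have keys: "Poly_Mapping.keys (part_exp xs) = {i. Suc i \<in> set xs}"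
    using assms by (auto simp: in_keys_iff lookup_part_exp count_list_0_iff)
  have "set xs = Suc ` {i. Suc i \<in> set xs}"
    using assms by (auto simp: image_iff) (metis not0_implies_Suc)
  then have "zee xs = (\<Prod>i\<in>Suc ` {i. Suc i \<in> set xs}. i ^ count_list xs i * fact (count_list xs i))"
    by (simp add: zee_def)
  also have "\<dots> = zexp (part_exp xs)"
    by (subst prod.reindex) (simp_all add: zexp_def keys lookup_part_exp[OF assms])
  finally show ?thesis .
qed

lemma part_exp_surj: "\<exists>xs. 0 \<notin> set xs \<and> part_exp xs = \<nu>"
proof (induction \<nu> rule: exponent_induct)
  case zero
  show ?case by (rule exI[of _ "[]"]) simp
next
  case (add k \<nu>)
  then obtain xs where "0 \<notin> set xs" "part_exp xs = \<nu>" by blast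
  then show ?case by (intro exI[of _ "Suc k # xs"]) (simp add: part_exp_Cons)
qed

text \<open>A weakly decreasing list is determined by its multiplicities, and sorting provides one
  for any exponent vector. This turns the sums over partitions in \<open>heis_D\<close> into sums
  over exponent vectors.\<close>

lemma bij_betw_part_exp: "bij_betw part_exp (partitions_of n) {\<nu>. wt \<nu> = n}"
proof (rule bij_betw_imageI)
  show "inj_on part_exp (partitions_of n)"
  proof (rule inj_onI)
    fix xs ys assume xs: "xs \<in> partitions_of n" and ys: "ys \<in> partitions_of n"
      and eq: "part_exp xs = part_exp ys"
    have "count_list xs x = count_list ys x" for x
      using xs ys arg_cong[OF eq, of "\<lambda>\<nu>. Poly_Mapping.lookup \<nu> (x - 1)"]
      by (cases x) (auto simp: partitions_of_def lookup_part_exp count_list_0_iff)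
    then have "mset (rev xs) = mset (rev ys)"
      by (intro multiset_eqI) (simp add: count_mset)
    moreover have "sorted (rev xs)" "sorted (rev ys)"
      using xs ys by (simp_all add: partitions_of_def sorted_wrt_rev)
    ultimately have "rev xs = rev ys" by (metis properties_for_sort)
    then show "xs = ys" by simp
  qed
  show "part_exp ` partitions_of n = {\<nu>. wt \<nu> = n}"
  proof
    show "part_exp ` partitions_of n \<subseteq> {\<nu>. wt \<nu> = n}"
      by (auto simp: partitions_of_def wt_part_exp)
    show "{\<nu>. wt \<nu> = n} \<subseteq> part_exp ` partitions_of n"
    proof
      fix \<nu> assume "\<nu> \<in> {\<nu>. wt \<nu> = n}"
      moreover obtain xs where xs: "0 \<notin> set xs" "part_exp xs = \<nu>" using part_exp_surj by blast
      let ?ys = "rev (sort xs)"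
      have ys: "0 \<notin> set ?ys" using xs by simp
      have "part_exp ?ys = \<nu>"
        unfolding xs(2)[symmetric]
        by (rule poly_mapping_eqI) (simp only: lookup_part_exp[OF xs(1)] lookup_part_exp[OF ys],
          simp add: count_mset[symmetric])
      moreover from this have "sum_list ?ys = wt \<nu>" using wt_part_exp[OF ys] by simp
      ultimately show "\<nu> \<in> part_exp ` partitions_of n"
        using ys by (intro image_eqI[of _ _ ?ys]) (auto simp: partitions_of_def sorted_wrt_rev)
    qed
  qed
qed

section \<open>Adjoint operators on coefficient functions\<close>

text \<open>
  Under \<open>\<phi> \<mu> = zexp \<mu> * lookup P \<mu>\<close>, which turns \<open>k \<partial>/\<partial>p\<^sub>k\<close> into a shift of the argument,
  \<open>Wop\<close> is multiplication by a power sum and \<open>Dop\<close> is the adjoint of multiplication by the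
  complete symmetric function \<open>h\<^sub>n\<close>.
\<close>

definition Dop :: "nat \<Rightarrow> ((nat \<Rightarrow>\<^sub>0 nat) \<Rightarrow> 'k::field_char_0) \<Rightarrow> (nat \<Rightarrow>\<^sub>0 nat) \<Rightarrow> 'k" where
  "Dop n \<phi> \<mu> = (\<Sum>\<nu> | wt \<nu> = n. inverse (of_nat (zexp \<nu>)) * \<phi> (\<nu> + \<mu>))"

definition Wop :: "nat \<Rightarrow> ((nat \<Rightarrow>\<^sub>0 nat) \<Rightarrow> 'k::field_char_0) \<Rightarrow> (nat \<Rightarrow>\<^sub>0 nat) \<Rightarrow> 'k" where
  "Wop k \<phi> \<mu> = of_nat (Suc k * Poly_Mapping.lookup \<mu> k) * \<phi> (\<mu> - Poly_Mapping.single k 1)"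

text \<open>The length L is kept apart from \<alpha>: inductions run over it, and exponent vectors
  of smaller degree can share it.\<close>

definition Dseq :: "(nat \<Rightarrow>\<^sub>0 nat) \<Rightarrow> nat \<Rightarrow> ((nat \<Rightarrow>\<^sub>0 nat) \<Rightarrow> 'k::field_char_0) \<Rightarrow> (nat \<Rightarrow>\<^sub>0 nat) \<Rightarrow> 'k" where
  "Dseq \<alpha> L = fold (\<lambda>i. Dop (Poly_Mapping.lookup \<alpha> i)) [0..<L]"

lemma Dseq_0 [simp]: "Dseq \<alpha> 0 \<phi> = \<phi>"
  by (simp add: Dseq_def)

lemma Dseq_Suc: "Dseq \<alpha> (Suc L) \<phi> = Dop (Poly_Mapping.lookup \<alpha> L) (Dseq \<alpha> L \<phi>)"
  by (simp add: Dseq_def)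

lemma Dop_add: "Dop n (\<lambda>\<mu>. \<phi> \<mu> + \<psi> \<mu>) = (\<lambda>\<mu>. Dop n \<phi> \<mu> + Dop n \<psi> \<mu>)"
  by (simp add: Dop_def fun_eq_iff distrib_left sum.distrib)

lemma Dop_zero [simp]: "Dop n (\<lambda>\<mu>. 0) = (\<lambda>\<mu>. 0)"
  by (simp add: Dop_def fun_eq_iff)

lemma Dop_sum: "Dop n (\<lambda>\<mu>. \<Sum>j\<in>J. \<phi> j \<mu>) = (\<lambda>\<mu>. \<Sum>j\<in>J. Dop n (\<phi> j) \<mu>)"
  by (induction J rule: infinite_finite_induct) (simp_all add: Dop_add)

lemma Dop_0: "Dop 0 \<phi> = \<phi>"
proof -
  have "{\<nu>. wt \<nu> = 0} = {0}"
  proof -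
    have "\<nu> = 0" if "wt \<nu> = 0" for \<nu>
    proof -
      have "\<forall>i\<in>Poly_Mapping.keys \<nu>. Suc i * Poly_Mapping.lookup \<nu> i = 0"
        using that by (subst sum_eq_0_iff[symmetric]) (simp_all add: wt_def)
      then show ?thesis by (intro poly_mapping_eqI) (auto simp: in_keys_iff)
    qed
    then show ?thesis by auto
  qed
  then show ?thesis by (simp add: Dop_def fun_eq_iff)
qed

text \<open>The entry of \<nu> + \<mu> at k is a sum, and the left side splits accordingly. The
  share of \<mu> is \<open>Wop\<close> after \<open>Dop\<close>. The share of \<nu> vanishes without
  a part k + 1; otherwise one such part is removed, its factor cancels against \<open>zexp\<close>,
  and the weight n - (k + 1) is left.\<close>

lemma Dop_Wop:
  "Dop n (Wop k \<phi>) \<mu> = Wop k (Dop n \<phi>) \<mu> + (if Suc k \<le> n then Dop (n - Suc k) \<phi> \<mu> else 0)"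
proof -
  let ?e = "Poly_Mapping.single k (1::nat)"
  let ?z = "\<lambda>\<nu>. inverse (of_nat (zexp \<nu>)) :: 'a"
  let ?l = "Poly_Mapping.lookup"
  \<comment> \<open>For a zero entry both sides vanish; otherwise the subtraction can be moved to
    \<mu> without truncation.\<close>
  have A: "of_nat (Suc k * ?l \<mu> k) * \<phi> (\<nu> + \<mu> - ?e) = of_nat (Suc k * ?l \<mu> k) * \<phi> (\<nu> + (\<mu> - ?e))" for \<nu>
    by (cases "?l \<mu> k = 0") (simp_all add: minus_single_add_commute)
  have "Dop n (Wop k \<phi>) \<mu> = (\<Sum>\<nu> | wt \<nu> = n. ?z \<nu> * (of_nat (Suc k * ?l \<mu> k) * \<phi> (\<nu> + \<mu> - ?e))) +
      (\<Sum>\<nu> | wt \<nu> = n. ?z \<nu> * (of_nat (Suc k * ?l \<nu> k) * \<phi> (\<nu> + \<mu> - ?e)))"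
    unfolding Dop_def Wop_def sum.distrib[symmetric]
    by (rule sum.cong) (simp_all add: lookup_add algebra_simps)
  also have "(\<Sum>\<nu> | wt \<nu> = n. ?z \<nu> * (of_nat (Suc k * ?l \<mu> k) * \<phi> (\<nu> + \<mu> - ?e))) = Wop k (Dop n \<phi>) \<mu>"
    unfolding A Wop_def Dop_def sum_distrib_left by (rule sum.cong) (simp_all add: algebra_simps)
  also have "(\<Sum>\<nu> | wt \<nu> = n. ?z \<nu> * (of_nat (Suc k * ?l \<nu> k) * \<phi> (\<nu> + \<mu> - ?e))) =
      (\<Sum>\<nu> | wt \<nu> + Suc k = n. ?z \<nu> * \<phi> (\<nu> + \<mu>))"
  \<comment> \<open>\<open>T'\<close> collects the terms with factor 0; the others are reached
    bijectively by adding one unit at k.\<close>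
  proof (rule sum.reindex_bij_betw_not_neutral[symmetric,
        where S' = "{}" and T' = "{\<nu>. wt \<nu> = n \<and> ?l \<nu> k = 0}" and h = "\<lambda>\<nu>. ?e + \<nu>", THEN trans])
    show "bij_betw ((+) ?e) ({\<nu>. wt \<nu> + Suc k = n} - {}) ({\<nu>. wt \<nu> = n} - {\<nu>. wt \<nu> = n \<and> ?l \<nu> k = 0})"
    proof (rule bij_betwI[where g = "\<lambda>\<nu>. \<nu> - ?e"])
      have e: "?e + (\<nu> - ?e) = \<nu>" if "0 < ?l \<nu> k" for \<nu>
        using that single_add_eq_iff[of k 1 "\<nu> - ?e" \<nu>] by simp
      have "wt \<nu> = Suc k + wt (\<nu> - ?e)" if "0 < ?l \<nu> k" for \<nu>
        using wt_add[of ?e "\<nu> - ?e"] e[OF that] by simp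
      then show "(\<lambda>\<nu>. \<nu> - ?e) \<in> {\<nu>. wt \<nu> = n} - {\<nu>. wt \<nu> = n \<and> ?l \<nu> k = 0} \<rightarrow> {\<nu>. wt \<nu> + Suc k = n} - {}"
        by (fastforce simp del: add_Suc_right)
      show "\<And>\<nu>. \<nu> \<in> {\<nu>. wt \<nu> = n} - {\<nu>. wt \<nu> = n \<and> ?l \<nu> k = 0} \<Longrightarrow> ?e + (\<nu> - ?e) = \<nu>"
        using e by simp
    qed (auto simp: wt_add lookup_add)
    show "(\<Sum>\<nu> | wt \<nu> + Suc k = n. ?z (?e + \<nu>) * (of_nat (Suc k * ?l (?e + \<nu>) k) * \<phi> (?e + \<nu> + \<mu> - ?e))) =
        (\<Sum>\<nu> | wt \<nu> + Suc k = n. ?z \<nu> * \<phi> (\<nu> + \<mu>))"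
    proof (rule sum.cong[OF refl])
      fix \<nu>
      have "?e + \<nu> + \<mu> - ?e = \<nu> + \<mu>" by (metis add.assoc add_diff_cancel_left')
      moreover have "?z (?e + \<nu>) * of_nat (Suc k * ?l (?e + \<nu>) k) = ?z \<nu>"
      proof -
        have cancel: "inverse (of_nat (c * z)) * of_nat c = (inverse (of_nat z) :: 'a)" if "c \<noteq> 0" for c z :: nat
          using that by simp
        show ?thesis
          unfolding zexp_add_single lookup_add lookup_single_eq plus_1_eq_Suc by (rule cancel) simp
      qed
      ultimately show "?z (?e + \<nu>) * (of_nat (Suc k * ?l (?e + \<nu>) k) * \<phi> (?e + \<nu> + \<mu> - ?e)) = ?z \<nu> * \<phi> (\<nu> + \<mu>)"
        by (simp only: mult.assoc[symmetric])
    qed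
    show "finite {\<nu>. wt \<nu> = n \<and> ?l \<nu> k = 0}"
      by (rule finite_subset[OF _ finite_wt[of n]]) auto
  qed simp_all
  also have "\<dots> = (if Suc k \<le> n then Dop (n - Suc k) \<phi> \<mu> else 0)"
    unfolding Dop_def by (auto intro!: sum.cong sum.neutral)
  finally show ?thesis .
qed

text \<open>Iterates \<open>Dop_Wop\<close>. The operator at position L is either unchanged, which
  keeps the terms j < L, or itself lowered by k + 1, which is the term j = L. Evaluated at 0 this is
  the recursion of \<open>symfun_coeff_power_sum_mult\<close>.\<close>

lemma Dseq_Wop:
  "Dseq \<alpha> L (Wop k \<phi>) = (\<lambda>\<mu>. Wop k (Dseq \<alpha> L \<phi>) \<mu> +
    (\<Sum>j | j < L \<and> Suc k \<le> Poly_Mapping.lookup \<alpha> j. Dseq (\<alpha> - Poly_Mapping.single j (Suc k)) L \<phi> \<mu>))"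
proof (induction L)
  case (Suc L)
  let ?l = "Poly_Mapping.lookup" and ?r = "\<lambda>j. \<alpha> - Poly_Mapping.single j (Suc k)"
  let ?J = "\<lambda>L. {j. j < L \<and> Suc k \<le> ?l \<alpha> j}"
  have last: "Dseq (?r L) L \<phi> = Dseq \<alpha> L \<phi>"
    unfolding Dseq_def by (rule fold_cong) (auto simp: lookup_minus lookup_single when_def)
  have step: "Dop (?l \<alpha> L) (Dseq (?r j) L \<phi>) = Dseq (?r j) (Suc L) \<phi>" if "j < L" for j
    using that by (simp add: Dseq_Suc lookup_minus lookup_single when_def)
  have J: "?J (Suc L) = (if Suc k \<le> ?l \<alpha> L then insert L (?J L) else ?J L)"
    by (auto simp: less_Suc_eq)
  show ?case
  proof
    fix \<mu>
    have "Dseq \<alpha> (Suc L) (Wop k \<phi>) \<mu> = Dop (?l \<alpha> L) (Wop k (Dseq \<alpha> L \<phi>)) \<mu> +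
        (\<Sum>j\<in>?J L. Dop (?l \<alpha> L) (Dseq (?r j) L \<phi>) \<mu>)"
      by (simp add: Dseq_Suc Suc.IH Dop_add Dop_sum)
    also have "\<dots> = Wop k (Dseq \<alpha> (Suc L) \<phi>) \<mu> +
        ((if Suc k \<le> ?l \<alpha> L then Dop (?l \<alpha> L - Suc k) (Dseq \<alpha> L \<phi>) \<mu> else 0) +
        (\<Sum>j\<in>?J L. Dseq (?r j) (Suc L) \<phi> \<mu>))"
      by (simp add: Dop_Wop Dseq_Suc[of \<alpha>] step add.assoc)
    also have "(if Suc k \<le> ?l \<alpha> L then Dop (?l \<alpha> L - Suc k) (Dseq \<alpha> L \<phi>) \<mu> else 0) +
        (\<Sum>j\<in>?J L. Dseq (?r j) (Suc L) \<phi> \<mu>) = (\<Sum>j\<in>?J (Suc L). Dseq (?r j) (Suc L) \<phi> \<mu>)"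
      unfolding J by (simp add: Dseq_Suc[of "?r L"] last lookup_minus)
    finally show "Dseq \<alpha> (Suc L) (Wop k \<phi>) \<mu> = Wop k (Dseq \<alpha> (Suc L) \<phi>) \<mu> +
        (\<Sum>j\<in>?J (Suc L). Dseq (?r j) (Suc L) \<phi> \<mu>)" .
  qed
qed simp

lemma Dseq_add: "Dseq \<alpha> L (\<lambda>\<mu>. \<phi> \<mu> + \<psi> \<mu>) = (\<lambda>\<mu>. Dseq \<alpha> L \<phi> \<mu> + Dseq \<alpha> L \<psi> \<mu>)"
  by (induction L) (simp_all add: Dseq_Suc Dop_add)

text \<open>The case of constant polynomials. For n > 0 the operator \<open>Dop n\<close> evaluates
  only at vectors of weight at least n and so never reaches the entry at 0.\<close>

lemma Dseq_delta:
  "Dseq \<alpha> L (\<lambda>\<mu>. if \<mu> = 0 then c else 0) =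
    (if \<forall>i<L. Poly_Mapping.lookup \<alpha> i = 0 then \<lambda>\<mu>. if \<mu> = 0 then c else 0 else (\<lambda>\<mu>. 0))"
proof (induction L)
  case (Suc L)
  have "Dop n (\<lambda>\<mu>. if \<mu> = 0 then c else 0) = (\<lambda>\<mu>. 0)" if "n \<noteq> 0" for n
  proof
    fix \<mu>
    have "\<nu> + \<mu> \<noteq> 0" if "wt \<nu> = n" for \<nu>
      using that \<open>n \<noteq> 0\<close> wt_add[of \<nu> \<mu>] by auto
    then show "Dop n (\<lambda>\<mu>. if \<mu> = 0 then c else 0) \<mu> = 0"
      by (simp add: Dop_def)
  qed
  then show ?case by (auto simp: Dseq_Suc Suc.IH Dop_0 less_Suc_eq)
qed simp

lemma coeff_eval_p_Dseq:
  fixes P :: "(nat \<Rightarrow>\<^sub>0 nat) \<Rightarrow>\<^sub>0 'k::field_char_0"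
  assumes "Poly_Mapping.degree \<alpha> \<le> L"
  shows "symfun_coeff (eval_p P) \<alpha> = Dseq \<alpha> L (\<lambda>\<mu>. of_nat (zexp \<mu>) * Poly_Mapping.lookup P \<mu>) 0"
  using assms
proof (induction P arbitrary: \<alpha> L rule: poly_mapping_add_induct)
  case (single \<nu> c)
  then show ?case
  proof (induction \<nu> arbitrary: \<alpha> L rule: exponent_induct)
    case zero
    have "(\<lambda>\<mu>. of_nat (zexp \<mu>) * Poly_Mapping.lookup (Poly_Mapping.single 0 c) \<mu>) =
        (\<lambda>\<mu>. if \<mu> = 0 then c else 0)"
      by (auto simp: lookup_single when_def)
    moreover have "(\<forall>i<L. Poly_Mapping.lookup \<alpha> i = 0) \<longleftrightarrow> \<alpha> = 0"
      using zero beyond_degree_lookup_zero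
      by (metis linorder_not_le lookup_zero order_trans poly_mapping_eqI)
    ultimately show ?case
      by (simp add: eval_p_single Dseq_delta symfun_scale.rep_eq one_symfun.rep_eq)
  next
    case (add k \<nu>)
    let ?P = "Poly_Mapping.single \<nu> c" and ?X = "Poly_Mapping.single (Poly_Mapping.single k 1) (1 :: 'k)"
    let ?\<phi> = "\<lambda>P \<mu>. of_nat (zexp \<mu>) * Poly_Mapping.lookup P \<mu> :: 'k"
    have P: "Poly_Mapping.single (Poly_Mapping.single k 1 + \<nu>) c = ?X * ?P"
      by (simp add: mult_single)
    have W: "?\<phi> (?X * ?P) = Wop k (?\<phi> ?P)"
    proof
      fix \<mu>
      show "?\<phi> (?X * ?P) \<mu> = Wop k (?\<phi> ?P) \<mu>"
      proof (cases "Poly_Mapping.lookup \<mu> k = 0")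
        case False
        then have "Poly_Mapping.single k 1 + (\<mu> - Poly_Mapping.single k 1) = \<mu>"
          using single_add_eq_iff[of k 1 _ \<mu>] by simp
        then have "zexp \<mu> = Suc k * Poly_Mapping.lookup \<mu> k * zexp (\<mu> - Poly_Mapping.single k 1)"
          using zexp_add_single[of k "\<mu> - Poly_Mapping.single k 1"] False by (simp add: lookup_minus)
        then show ?thesis
          using False by (simp add: lookup_var_mult Wop_def del: of_nat_Suc)
      qed (simp add: lookup_var_mult Wop_def)
    qed
    have "symfun_coeff (eval_p (?X * ?P)) \<alpha> =
        (\<Sum>j | Suc k \<le> Poly_Mapping.lookup \<alpha> j. symfun_coeff (eval_p ?P) (\<alpha> - Poly_Mapping.single j (Suc k)))"
      by (simp only: eval_p_var_mult symfun_coeff_power_sum_mult)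
    also have "\<dots> = (\<Sum>j | Suc k \<le> Poly_Mapping.lookup \<alpha> j. Dseq (\<alpha> - Poly_Mapping.single j (Suc k)) L (?\<phi> ?P) 0)"
    proof (rule sum.cong[OF refl], rule add.IH)
      fix j
      have "Poly_Mapping.keys (\<alpha> - Poly_Mapping.single j (Suc k)) \<subseteq> Poly_Mapping.keys \<alpha>"
        by (auto simp: in_keys_iff lookup_minus)
      then have "Poly_Mapping.degree (\<alpha> - Poly_Mapping.single j (Suc k)) \<le> Poly_Mapping.degree \<alpha>"
        unfolding Poly_Mapping.degree_def by (intro Max_mono) auto
      then show "Poly_Mapping.degree (\<alpha> - Poly_Mapping.single j (Suc k)) \<le> L"
        using add.prems by simp
    qed
    also have "{j. Suc k \<le> Poly_Mapping.lookup \<alpha> j} = {j. j < L \<and> Suc k \<le> Poly_Mapping.lookup \<alpha> j}"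
    proof -
      have "j < L" if "Suc k \<le> Poly_Mapping.lookup \<alpha> j" for j
        using that add.prems beyond_degree_lookup_zero[of \<alpha> j]
        by (cases "Poly_Mapping.degree \<alpha> \<le> j") auto
      then show ?thesis by blast
    qed
    also have "(\<Sum>j | j < L \<and> Suc k \<le> Poly_Mapping.lookup \<alpha> j.
        Dseq (\<alpha> - Poly_Mapping.single j (Suc k)) L (?\<phi> ?P) 0) = Dseq \<alpha> L (Wop k (?\<phi> ?P)) 0"
      \<comment> \<open>At the exponent vector 0 the first summand of \<open>Dseq_Wop\<close>
        vanishes, as \<open>Wop\<close> carries the factor \<open>lookup 0 k\<close>.\<close>
      by (simp only: Dseq_Wop) (simp add: Wop_def)
    finally show ?case unfolding P W .
  qed
next
  case (add P Q)
  then show ?case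
    by (simp add: eval_p_add plus_symfun.rep_eq lookup_add distrib_left Dseq_add)
qed

section \<open>The map into symmetric functions\<close>

text \<open>As a multiset, the exponent vector can be fed to \<open>fold_mset\<close>, which forms
  products of commuting operators without choosing an order.\<close>

definition exp_mset :: "(nat \<Rightarrow>\<^sub>0 nat) \<Rightarrow> nat multiset" where
  "exp_mset \<mu> = Abs_multiset (Poly_Mapping.lookup \<mu>)"

lemma count_exp_mset: "count (exp_mset \<mu>) i = Poly_Mapping.lookup \<mu> i"
  unfolding exp_mset_def by (subst count_Abs_multiset) simp_all

lemma exp_mset_0 [simp]: "exp_mset 0 = {#}"
  by (rule multiset_eqI) (simp add: count_exp_mset)

lemma exp_mset_add_single: "exp_mset (Poly_Mapping.single k 1 + \<mu>) = add_mset k (exp_mset \<mu>)"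
  by (rule multiset_eqI) (auto simp: count_exp_mset lookup_add lookup_single when_def)

section \<open>Monomials in the commuting lowering operators\<close>

context heis_rep
begin

definition lower :: "nat \<Rightarrow> 'v \<Rightarrow> 'v" where
  "lower i = act (heis_B a (int (Suc i)))"

definition opmon :: "(nat \<Rightarrow>\<^sub>0 nat) \<Rightarrow> 'v \<Rightarrow> 'v" where
  "opmon \<mu> x = fold_mset lower x (exp_mset \<mu>)"

lemma lower_commute: "lower i (lower j x) = lower j (lower i x)"
  unfolding lower_def using act_B_commute[of "int (Suc i)" "int (Suc j)" x] by simp

sublocale lower: comp_fun_commute lower
  by unfold_locales (simp add: fun_eq_iff lower_commute)

lemma lower_linear: "Vector_Spaces.linear scale scale (lower i)"
  unfolding lower_def by (rule act_linear) simp

lemma opmon_0 [simp]: "opmon 0 x = x"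
  by (simp add: opmon_def)

lemma opmon_add_single: "opmon (Poly_Mapping.single k 1 + \<mu>) x = lower k (opmon \<mu> x)"
  unfolding opmon_def exp_mset_add_single by simp

lemma opmon_lower: "opmon \<mu> (lower k x) = opmon (Poly_Mapping.single k 1 + \<mu>) x"
  unfolding opmon_def exp_mset_add_single by (simp add: lower.fold_mset_fun_left_comm)

lemma opmon_opmon: "opmon \<mu> (opmon \<nu> x) = opmon (\<nu> + \<mu>) x"
proof (induction \<nu> arbitrary: x rule: exponent_induct)
  case (add k \<nu>)
  then show ?case
    using opmon_add_single opmon_lower by (metis add.assoc)
qed simp

lemma opmon_linear: "Vector_Spaces.linear scale scale (opmon \<mu>)"
proof (induction \<mu> rule: exponent_induct)
  case zero
  show ?case by unfold_locales simp_all
next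
  case (add k \<mu>)
  show ?case
    using Vector_Spaces.linear_compose[OF add lower_linear[of k]]
    by (simp add: o_def opmon_add_single[abs_def])
qed

lemma foldr_act_B:
  "0 \<notin> set xs \<Longrightarrow> foldr (\<lambda>i. act (heis_B a (int i))) xs x = opmon (part_exp xs) x"
  by (induction xs) (auto simp: part_exp_Cons opmon_add_single lower_def)

lemma finite_partitions_of: "finite (partitions_of n)"
  using bij_betw_finite[OF bij_betw_part_exp] finite_wt by blast

lemma act_heis_D_opmon:
  "act (heis_D a n) x = (\<Sum>\<nu> | wt \<nu> = n. scale (inverse (of_nat (zexp \<nu>))) (opmon \<nu> x))"
proof -
  have "act (heis_D a n) x =
      (\<Sum>xs\<in>partitions_of n. scale (inverse (of_nat (zexp (part_exp xs)))) (opmon (part_exp xs) x))"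
    unfolding act_heis_D[OF finite_partitions_of]
    by (rule sum.cong) (auto simp: partitions_of_def zee_part_exp foldr_act_B)
  also have "\<dots> = (\<Sum>\<nu> | wt \<nu> = n. scale (inverse (of_nat (zexp \<nu>))) (opmon \<nu> x))"
    by (rule sum.reindex_bij_betw[OF bij_betw_part_exp])
  finally show ?thesis .
qed

text \<open>The raising operator moves left past one lowering operator at a time. Each of the
  \<open>lookup \<mu> k\<close> factors that do not commute with it leaves the scalar c in its own
  place.\<close>

lemma opmon_act_raise:
  fixes k :: nat
  defines "c \<equiv> of_nat (Suc k) * a (int (Suc k))"
  shows "opmon \<mu> (act (heis_B a (- int (Suc k))) x) = act (heis_B a (- int (Suc k))) (opmon \<mu> x) +
    scale (of_nat (Poly_Mapping.lookup \<mu> k) * c) (opmon (\<mu> - Poly_Mapping.single k 1) x)"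
proof (induction \<mu> rule: exponent_induct)
  case (add i \<mu>)
  interpret lower: Vector_Spaces.linear scale scale "lower i" by (rule lower_linear)
  let ?e = "Poly_Mapping.single i (1::nat)" and ?d = "Poly_Mapping.single k (1::nat)"
  let ?l = "of_nat (Poly_Mapping.lookup \<mu> k) :: 'k"
  have comm: "lower i (act (heis_B a (- int (Suc k))) y) =
      act (heis_B a (- int (Suc k))) (lower i y) + (if i = k then scale c y else 0)" for y
    unfolding lower_def
    by (subst act_B_commute) (auto simp: c_def simp flip: of_nat_Suc)
  \<comment> \<open>If k does not occur in \<mu> the scalar is 0; otherwise the subtraction does not
    truncate.\<close>
  have shift: "scale (?l * c) (lower i (opmon (\<mu> - ?d) x)) =
      scale (?l * c) (opmon (?e + \<mu> - ?d) x)"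
    by (cases "Poly_Mapping.lookup \<mu> k = 0")
      (simp_all add: minus_single_add_commute opmon_add_single)
  have "opmon (?e + \<mu>) (act (heis_B a (- int (Suc k))) x) =
      act (heis_B a (- int (Suc k))) (opmon (?e + \<mu>) x) + (if i = k then scale c (opmon \<mu> x) else 0) +
      scale (?l * c) (opmon (?e + \<mu> - ?d) x)"
    by (simp only: opmon_add_single add.IH lower.add lower.scale comm shift)
  also have "\<dots> = act (heis_B a (- int (Suc k))) (opmon (?e + \<mu>) x) +
      scale (of_nat (Poly_Mapping.lookup (?e + \<mu>) k) * c) (opmon (?e + \<mu> - ?d) x)"
    by (auto simp: lookup_add lookup_single when_def distrib_right scale_left_distrib add.assoc)
  finally show ?case .
qed simp

end

section \<open>Matrix coefficients against a functional that kills the images of the raising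
  operators\<close>

locale dual_heis_rep = graded_heis_rep scale a act v sdeg comp m form
  for scale :: "'k::field_char_0 \<Rightarrow> 'v::ab_group_add \<Rightarrow> 'v"
    and a act v and sdeg :: "'s \<Rightarrow> int" and comp m form +
  fixes b :: 's
  assumes form_raise: "k > 0 \<Longrightarrow> form (act (heis_B a (- k)) x) (v b) = 0"
begin

definition coeff_b :: "'v \<Rightarrow> 'k" where
  "coeff_b x = form x (v b)"

text \<open>This is \<open>zexp \<mu>\<close> times the coefficient of \<open>to_poly x\<close> at
  \<mu>, the normalization on which \<open>Dop\<close> and \<open>Wop\<close> act.\<close>

definition matrix_coeff :: "'v \<Rightarrow> (nat \<Rightarrow>\<^sub>0 nat) \<Rightarrow> 'k" where
  "matrix_coeff x \<mu> = coeff_b (opmon \<mu> x)"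

lemma coeff_b_linear: "Vector_Spaces.linear scale (*) coeff_b"
  unfolding coeff_b_def by (rule form_linear_left)

interpretation coeff_b: Vector_Spaces.linear scale "(*)" coeff_b
  by (rule coeff_b_linear)

interpretation opmon: Vector_Spaces.linear scale scale "opmon \<mu>" for \<mu>
  by (rule opmon_linear)

lemma matrix_coeff_add: "matrix_coeff (x + y) \<mu> = matrix_coeff x \<mu> + matrix_coeff y \<mu>"
  by (simp add: matrix_coeff_def opmon.add coeff_b.add)

lemma matrix_coeff_scale: "matrix_coeff (scale c x) \<mu> = c * matrix_coeff x \<mu>"
  by (simp add: matrix_coeff_def opmon.scale coeff_b.scale)

lemma matrix_coeff_heis_D: "matrix_coeff (act (heis_D a n) x) = Dop n (matrix_coeff x)"
  by (rule ext)
    (simp add: matrix_coeff_def act_heis_D_opmon opmon.sum opmon.scale coeff_b.sum coeff_b.scale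
      opmon_opmon Dop_def)

lemma matrix_coeff_fold_heis_D:
  "matrix_coeff (fold (\<lambda>i. act (heis_D a (Poly_Mapping.lookup \<alpha> i))) [0..<L] x) =
    Dseq \<alpha> L (matrix_coeff x)"
  by (induction L) (simp_all add: Dseq_Suc matrix_coeff_heis_D)

lemma coeff_b_act_heis_D_seq:
  "form (act (heis_D_seq a \<alpha>) x) (v b) = Dseq \<alpha> (Poly_Mapping.degree \<alpha>) (matrix_coeff x) 0"
  unfolding act_heis_D_seq matrix_coeff_fold_heis_D[symmetric]
  by (simp add: matrix_coeff_def coeff_b_def)

text \<open>The expansion of x in the basis, grouped by degree, and x itself placed in degree n are
  two homogeneous decompositions of x. By uniqueness the group of degree \<open>sdeg b\<close> is
  zero, and it alone can involve \<open>v b\<close>.\<close>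

lemma coeff_b_off_degree:
  assumes "x \<in> comp n" "n \<noteq> sdeg b"
  shows "coeff_b x = 0"
proof -
  obtain T r where T: "finite T" "T \<subseteq> range v" "x = (\<Sum>t\<in>T. scale (r t) t)"
    using basis(3) span_explicit[of "range v"] by blast
  define S where "S = v -` T"
  have S: "finite S" "x = (\<Sum>s\<in>S. scale (r (v s)) (v s))"
  proof -
    show "finite S" unfolding S_def by (rule finite_vimageI[OF T(1) basis(1)])
    have "T = v ` S" using T(2) by (auto simp: S_def)
    then show "x = (\<Sum>s\<in>S. scale (r (v s)) (v s))"
      unfolding T(3) using basis(1) by (simp add: sum.reindex inj_on_subset o_def)
  qed
  define f where "f = (\<lambda>d. \<Sum>s\<in>{s\<in>S. sdeg s = d}. scale (r (v s)) (v s))"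
  have "f d \<in> comp d" for d
    unfolding f_def using basis_homogeneous
    by (auto intro!: subspace_sum[OF comp_subspace] subspace_scale[OF comp_subspace])
  moreover have supp: "{d. f d \<noteq> 0} \<subseteq> sdeg ` S"
    unfolding f_def by (auto elim!: sum.not_neutral_contains_not_neutral)
  moreover have "x = (\<Sum>d | f d \<noteq> 0. f d)"
  proof -
    have "(\<Sum>d | f d \<noteq> 0. f d) = (\<Sum>d\<in>sdeg ` S. f d)"
      using supp S(1) by (intro sum.mono_neutral_left) auto
    also have "\<dots> = x"
      unfolding f_def S(2) by (rule sum.group) (use S(1) in auto)
    finally show ?thesis ..
  qed
  moreover define g where "g = (\<lambda>d. if d = n then x else 0)"
  have "g d \<in> comp d" for d
    using assms(1) subspace_0[OF comp_subspace] by (simp add: g_def)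
  moreover have "finite {d. g d \<noteq> 0}"
    by (rule finite_subset[of _ "{n}"]) (auto simp: g_def)
  moreover have "x = (\<Sum>d | g d \<noteq> 0. g d)"
    by (cases "x = 0") (simp_all add: g_def)
  ultimately have "f = g"
    using comp_direct_sum[of x] finite_subset[OF supp] S(1) by (metis finite_imageI)
  then have "f (sdeg b) = 0" using assms(2) by (simp add: g_def)
  moreover have "coeff_b (f (sdeg b)) = coeff_b x"
    unfolding f_def S(2) coeff_b.sum coeff_b.scale
    using S(1) by (intro sum.mono_neutral_left) (auto simp: coeff_b_def form_basis)
  ultimately show ?thesis by (metis coeff_b.zero)
qed

lemma opmon_graded: "x \<in> comp n \<Longrightarrow> opmon \<mu> x \<in> comp (n - m * int (wt \<mu>))"
proof (induction \<mu> rule: exponent_induct)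
  case (add k \<mu>)
  have "lower k (opmon \<mu> x) \<in> comp (n - m * int (wt \<mu>) - m * int (Suc k))"
    unfolding lower_def by (rule act_graded) (use add in simp_all)
  then show ?case
    by (simp only: opmon_add_single wt_add wt_single) (simp add: algebra_simps)
qed simp

text \<open>For a basis vector a nonzero value forces \<open>opmon \<mu> x\<close> into degree
  \<open>sdeg b\<close>. As m is nonzero this fixes \<open>wt \<mu>\<close>, and only finitely many
  \<mu> have a given weight. Linearity extends the claim to the span.\<close>

lemma finite_matrix_coeff: "finite {\<mu>. matrix_coeff x \<mu> \<noteq> 0}"
proof (rule span_induct[where S = "Set.range v" and P = "\<lambda>x. finite {\<mu>. matrix_coeff x \<mu> \<noteq> 0}"])
  show "x \<in> span (Set.range v)" using basis(3) by simp
  show "subspace {x. finite {\<mu>. matrix_coeff x \<mu> \<noteq> 0}}"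
  proof (rule subspaceI)
    have "matrix_coeff 0 \<mu> = 0" for \<mu>
      by (simp add: matrix_coeff_def opmon.zero coeff_b.zero)
    then show "0 \<in> {x. finite {\<mu>. matrix_coeff x \<mu> \<noteq> 0}}" by simp
  next
    fix x y assume *: "x \<in> {x. finite {\<mu>. matrix_coeff x \<mu> \<noteq> 0}}" "y \<in> {x. finite {\<mu>. matrix_coeff x \<mu> \<noteq> 0}}"
    have "{\<mu>. matrix_coeff (x + y) \<mu> \<noteq> 0} \<subseteq> {\<mu>. matrix_coeff x \<mu> \<noteq> 0} \<union> {\<mu>. matrix_coeff y \<mu> \<noteq> 0}"
      by (auto simp: matrix_coeff_add)
    then have "finite {\<mu>. matrix_coeff (x + y) \<mu> \<noteq> 0}"
      by (rule finite_subset) (use * in simp)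
    then show "x + y \<in> {x. finite {\<mu>. matrix_coeff x \<mu> \<noteq> 0}}" by simp
  next
    fix c x assume *: "x \<in> {x. finite {\<mu>. matrix_coeff x \<mu> \<noteq> 0}}"
    have "{\<mu>. matrix_coeff (scale c x) \<mu> \<noteq> 0} \<subseteq> {\<mu>. matrix_coeff x \<mu> \<noteq> 0}"
      by (auto simp: matrix_coeff_scale)
    then have "finite {\<mu>. matrix_coeff (scale c x) \<mu> \<noteq> 0}"
      by (rule finite_subset) (use * in simp)
    then show "scale c x \<in> {x. finite {\<mu>. matrix_coeff x \<mu> \<noteq> 0}}" by simp
  qed
next
  fix x assume "x \<in> Set.range v"
  then obtain s where x: "x = v s" by blast
  have "m * int (wt \<mu>) = sdeg s - sdeg b" if "matrix_coeff x \<mu> \<noteq> 0" for \<mu>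
  proof -
    have "sdeg s - m * int (wt \<mu>) = sdeg b"
      using coeff_b_off_degree[OF opmon_graded[OF basis_homogeneous[of s]], of \<mu>] that
      by (auto simp: matrix_coeff_def x)
    then show ?thesis by simp
  qed
  then have "wt \<mu> = nat ((sdeg s - sdeg b) div m)" if "matrix_coeff x \<mu> \<noteq> 0" for \<mu>
    using that m_nonzero by (metis nat_int nonzero_mult_div_cancel_left)
  then show "finite {\<mu>. matrix_coeff x \<mu> \<noteq> 0}"
    by (intro finite_subset[OF _ finite_wt[of "nat ((sdeg s - sdeg b) div m)"]]) auto
qed

definition to_poly :: "'v \<Rightarrow> (nat \<Rightarrow>\<^sub>0 nat) \<Rightarrow>\<^sub>0 'k" where
  "to_poly x = Abs_poly_mapping (\<lambda>\<mu>. inverse (of_nat (zexp \<mu>)) * matrix_coeff x \<mu>)"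

lemma lookup_to_poly:
  "Poly_Mapping.lookup (to_poly x) \<mu> = inverse (of_nat (zexp \<mu>)) * matrix_coeff x \<mu>"
proof -
  have "finite {\<mu>. inverse (of_nat (zexp \<mu>)) * matrix_coeff x \<mu> \<noteq> 0}"
    using finite_matrix_coeff by simp
  then show ?thesis by (simp add: to_poly_def)
qed

lemma symfun_coeff_eval_p_to_poly:
  "symfun_coeff (eval_p (to_poly x)) \<alpha> = form (act (heis_D_seq a \<alpha>) x) (v b)"
  unfolding coeff_b_act_heis_D_seq coeff_eval_p_Dseq[OF order_refl]
  by (simp add: lookup_to_poly mult.assoc[symmetric])

lemma eval_p_to_poly_linear: "Vector_Spaces.linear scale symfun_scale (\<lambda>x. eval_p (to_poly x))"
proof -
  interpret S: vector_space "symfun_scale :: 'k \<Rightarrow> _" by (rule vector_space_symfun_scale)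
  have "to_poly (x + y) = to_poly x + to_poly y" for x y
    by (rule poly_mapping_eqI) (simp add: lookup_to_poly lookup_add matrix_coeff_add distrib_left)
  moreover have "to_poly (scale c x) = Poly_Mapping.single 0 c * to_poly x" for c x
    by (rule poly_mapping_eqI)
      (simp add: lookup_to_poly lookup_const_mult matrix_coeff_scale mult.left_commute)
  ultimately show ?thesis
    by unfold_locales (simp_all add: eval_p_add eval_p_const_mult)
qed

text \<open>The lowering operator shifts \<mu> by one unit at k. The denominators
  \<open>zexp\<close> before and after the shift differ by (k + 1) times the new multiplicity, which
  the scalar and the derivative supply.\<close>

lemma eval_p_to_poly_lower:
  "eval_p (to_poly (act (heis_B a (int (Suc k))) x)) =
    symfun_scale (of_nat (Suc k)) (deriv_p (Suc k) (eval_p (to_poly x)))"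
proof -
  have "to_poly (lower k x) = Poly_Mapping.single 0 (of_nat (Suc k)) * pderiv_var k (to_poly x)"
  proof (rule poly_mapping_eqI)
    fix \<mu>
    have cancel: "inverse (of_nat z) * y = of_nat p * (of_nat q * (inverse (of_nat (p * q * z)) * y))"
      if "p \<noteq> 0" "q \<noteq> 0" for p q z :: nat and y :: 'k
    proof -
      have "of_nat p * (of_nat q * (inverse (of_nat (p * q * z)) * y)) =
          (of_nat p * inverse (of_nat p)) * (of_nat q * inverse (of_nat q)) * (inverse (of_nat z) * y)"
        by (simp only: of_nat_mult inverse_mult_distrib mult_ac)
      with that show ?thesis by simp
    qed
    show "Poly_Mapping.lookup (to_poly (lower k x)) \<mu> =
        Poly_Mapping.lookup (Poly_Mapping.single 0 (of_nat (Suc k)) * pderiv_var k (to_poly x)) \<mu>"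
      unfolding lookup_const_mult lookup_pderiv_var lookup_to_poly matrix_coeff_def opmon_lower
        zexp_add_single
      by (rule cancel) simp_all
  qed
  then show ?thesis
    by (simp only: lower_def eval_p_const_mult deriv_p_eval_p)
qed

text \<open>Moving the raising operator to the left leaves a term killed by
  \<open>form_raise\<close> and a multiple of the value at \<mu> minus one unit at k. Of its scalar,
  (k + 1) times the multiplicity cancels against \<open>zexp \<mu>\<close>, and the parameter
  \<open>a (int (Suc k))\<close> remains.\<close>

lemma eval_p_to_poly_raise:
  "eval_p (to_poly (act (heis_B a (- int (Suc k))) x)) =
    symfun_scale (a (int (Suc k))) (power_sum (Suc k) * eval_p (to_poly x))"
proof -
  let ?e = "Poly_Mapping.single k (1::nat)" and ?c = "a (int (Suc k))"
  have "to_poly (act (heis_B a (- int (Suc k))) x) =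
      Poly_Mapping.single 0 ?c * (Poly_Mapping.single ?e 1 * to_poly x)"
  proof (rule poly_mapping_eqI)
    fix \<mu>
    have "coeff_b (act (heis_B a (- int (Suc k))) y) = 0" for y
      unfolding coeff_b_def by (rule form_raise) simp
    then have M: "matrix_coeff (act (heis_B a (- int (Suc k))) x) \<mu> =
        of_nat (Poly_Mapping.lookup \<mu> k) * (of_nat (Suc k) * ?c) * matrix_coeff x (\<mu> - ?e)"
      unfolding matrix_coeff_def opmon_act_raise coeff_b.add coeff_b.scale by (simp only: add_0)
    show "Poly_Mapping.lookup (to_poly (act (heis_B a (- int (Suc k))) x)) \<mu> =
        Poly_Mapping.lookup (Poly_Mapping.single 0 ?c * (Poly_Mapping.single ?e 1 * to_poly x)) \<mu>"
    proof (cases "Poly_Mapping.lookup \<mu> k = 0")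
      case True
      then show ?thesis by (simp only: lookup_const_mult lookup_var_mult lookup_to_poly M) simp
    next
      case False
      have \<mu>: "?e + (\<mu> - ?e) = \<mu>"
        using single_add_eq_iff[of k 1 "\<mu> - ?e" \<mu>] False by simp
      have z: "zexp \<mu> = Suc k * Poly_Mapping.lookup \<mu> k * zexp (\<mu> - ?e)"
        using zexp_add_single[of k "\<mu> - ?e"] False by (simp add: \<mu> lookup_minus)
      have cancel: "inverse (of_nat (p * q * z)) * (of_nat q * (of_nat p * c) * y) =
          c * (inverse (of_nat z) * y)" if "p \<noteq> 0" "q \<noteq> 0" for p q z :: nat and c y :: 'k
      proof -
        have "inverse (of_nat (p * q * z)) * (of_nat q * (of_nat p * c) * y) =
            (of_nat p * inverse (of_nat p)) * (of_nat q * inverse (of_nat q)) * (c * (inverse (of_nat z) * y))"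
          by (simp only: of_nat_mult inverse_mult_distrib mult_ac)
        with that show ?thesis by simp
      qed
      show ?thesis
        unfolding lookup_const_mult lookup_var_mult lookup_to_poly if_not_P[OF False] M z
        by (rule cancel) (use False in simp_all)
    qed
  qed
  then show ?thesis by (simp only: eval_p_const_mult eval_p_var_mult)
qed

end

theorem theorem6:
  fixes scale :: "'k::field_char_0 \<Rightarrow> 'v::ab_group_add \<Rightarrow> 'v"
    and a :: "int \<Rightarrow> 'k"
    and act :: "'k free_heis set \<Rightarrow> 'v \<Rightarrow> 'v"
    and v :: "'s \<Rightarrow> 'v" and sdeg :: "'s \<Rightarrow> int"
    and comp :: "int \<Rightarrow> 'v set" and m :: int
    and form :: "'v \<Rightarrow> 'v \<Rightarrow> 'k" and b :: 's
  assumes a_nonzero: "\<And>k. k \<noteq> 0 \<Longrightarrow> a k \<noteq> 0"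
    and a_sym: "\<And>k. k \<noteq> 0 \<Longrightarrow> a k = a (- k)"
    and rep: "graded_heis_rep scale a act v sdeg comp m form"
    and hw: "graded_heis_rep.highest_weight a act (v b)"
    and hw_dual: "\<And>k x. k > 0 \<Longrightarrow> form (act (heis_B a (- k)) x) (v b) = 0"
  shows "\<exists>\<sigma> :: 'k free_heis set \<Rightarrow> 'k symfun \<Rightarrow> 'k symfun.
    heis_rep symfun_scale a \<sigma> \<and>
    (\<forall>k\<ge>1. \<forall>f. \<sigma> (heis_B a (- int k)) f = symfun_scale (a (int k)) (power_sum k * f)) \<and>
    (\<forall>k\<ge>1. \<forall>f. \<sigma> (heis_B a (int k)) f = symfun_scale (of_nat k) (deriv_p k f)) \<and>
    (\<exists>\<Phi> :: 'v \<Rightarrow> 'k symfun.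
      Vector_Spaces.linear scale symfun_scale \<Phi> \<and>
      (\<forall>s. symfun_coeff (\<Phi> (v s)) = graded_heis_rep.gen_fun a act v form s b) \<and>
      (\<forall>h\<in>carrier (heis a). \<forall>x. \<Phi> (act h x) = \<sigma> h (\<Phi> x)))"
proof -
  interpret graded_heis_rep scale a act v sdeg comp m form by (rule rep)
  interpret dual_heis_rep scale a act v sdeg comp m form b
    by unfold_locales (rule hw_dual)
  obtain \<sigma> where \<sigma>: "heis_rep symfun_scale a \<sigma>"
    "\<And>k f. k \<ge> 1 \<Longrightarrow> \<sigma> (heis_B a (- int k)) f = symfun_scale (a (int k)) (power_sum k * f)"
    "\<And>k f. k \<ge> 1 \<Longrightarrow> \<sigma> (heis_B a (int k)) f = symfun_scale (of_nat k) (deriv_p k f)"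
    using fock_rep_exists[of a] a_sym by blast
  \<comment> \<open>By \<open>heis_rep_intertwine\<close> only the generators need checking: a
    positive index is a derivative, a negative one a multiplication.\<close>
  have B: "eval_p (to_poly (act (heis_B a k) x)) = \<sigma> (heis_B a k) (eval_p (to_poly x))"
    if "k \<noteq> 0" for k x
  proof -
    obtain n where n: "k = int n \<or> k = - int n" by (cases k rule: int_cases2) auto
    with \<open>k \<noteq> 0\<close> obtain i where i: "n = Suc i" by (cases n) auto
    have "Suc i \<ge> 1" by simp
    from n show ?thesis
      unfolding i
    proof
      assume k: "k = int (Suc i)"
      show ?thesis unfolding k eval_p_to_poly_lower \<sigma>(3)[OF \<open>Suc i \<ge> 1\<close>] ..
    next
      assume k: "k = - int (Suc i)"
      show ?thesis unfolding k eval_p_to_poly_raise \<sigma>(2)[OF \<open>Suc i \<ge> 1\<close>] ..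
    qed
  qed
  show ?thesis
  proof (intro exI[of _ \<sigma>] exI[of _ "\<lambda>x. eval_p (to_poly x)"] conjI allI impI ballI ext)
    show "symfun_coeff (eval_p (to_poly (v s))) \<alpha> = gen_fun s b \<alpha>" for s \<alpha>
      by (simp add: symfun_coeff_eval_p_to_poly gen_fun_def)
    show "eval_p (to_poly (act h x)) = \<sigma> h (eval_p (to_poly x))" if "h \<in> carrier (heis a)" for h x
      by (rule heis_rep_intertwine[OF heis_rep_axioms \<sigma>(1) eval_p_to_poly_linear B that])
  qed (use \<sigma> eval_p_to_poly_linear in auto)
qed

end
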